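(* Let $n\ge 2$, $1\le r\le\infty$, and let $\omega=\sum_{j=1}^n\omega_j\,d\hat{\bar z}_j$ be a $(0,n-1)$-form with coefficients in $L^{r}_{c}(\mathbb{D}^n)$ such that $\bar\partial\omega=0$ and $\dfrac{\partial\omega_n}{\partial\bar z_n}\in L^{r}(\mathbb{C}^n)$. Then there is a $(0,n-2)$-form $\beta$ with coefficients in $L^{r}_{c}(\mathbb{D}^n)$ such that $\bar\partial\beta=\omega$.
   Context: $\mathbb{D}^n$ is the open unit polydisc in $\mathbb{C}^n$. $L^r_c(\mathbb{D}^n)$ is the space of $L^r$ functions with compact support contained in $\mathbb{D}^n$ (regarded as functions on $\mathbb{C}^n$ by extension by zero). $d\hat{\bar z}_j$ is the exterior product, in increasing order, of all $d\bar z_i$ with $i\ne j$. All derivatives are in the sense of distributions. *)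

theory Defs
  imports "HOL-Analysis.Analysis" "HOL-Probability.Essential_Supremum"
begin

section \<open>Lebesgue spaces and compact support\<close>

text \<open>Members of \<open>L\<^sup>r\<close> are represented by Lebesgue measurable functions; no notion below depends
  on the choice of the representative in its almost-everywhere class.\<close>

definition Lr_norm :: "ennreal \<Rightarrow> ('a::euclidean_space \<Rightarrow> complex) \<Rightarrow> ennreal" where
  "Lr_norm r f =
     (if r = \<infinity> then esssup lebesgue (\<lambda>x. ennreal (norm (f x)))
      else (let I = (\<integral>\<^sup>+ x. ennreal (norm (f x) powr enn2real r) \<partial>lebesgue)
            in if I = \<infinity> then \<infinity> else ennreal (enn2real I powr (1 / enn2real r))))"

definition Lr_space :: "ennreal \<Rightarrow> ('a::euclidean_space \<Rightarrow> complex) set" where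
  "Lr_space r = {f. f \<in> borel_measurable lebesgue \<and> Lr_norm r f < \<infinity>}"

definition ess_support :: "('a::euclidean_space \<Rightarrow> complex) \<Rightarrow> 'a set" where
  "ess_support f = - \<Union>{U. open U \<and> (AE x in lebesgue. x \<in> U \<longrightarrow> f x = 0)}"

definition Lr_c :: "ennreal \<Rightarrow> 'a::euclidean_space set \<Rightarrow> ('a \<Rightarrow> complex) set" where
  "Lr_c r D = {f \<in> Lr_space r. compact (ess_support f) \<and> ess_support f \<subseteq> D}"

definition polydisc :: "(complex ^ 'n::finite) set" where
  "polydisc = {z. \<forall>i. norm (z $ i) < 1}"


section \<open>Test functions and distributions\<close>

text \<open>Functions of class \<open>C\<^sup>k\<close> in the real sense.\<close>

primrec Ck :: "nat \<Rightarrow> ('a::euclidean_space \<Rightarrow> 'b::real_normed_vector) \<Rightarrow> bool" where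
  "Ck 0 f \<longleftrightarrow> continuous_on UNIV f"
| "Ck (Suc k) f \<longleftrightarrow>
     (\<forall>x. f differentiable (at x)) \<and> (\<forall>v. Ck k (\<lambda>x. frechet_derivative f (at x) v))"

definition test_function :: "('a::euclidean_space \<Rightarrow> complex) \<Rightarrow> bool" where
  "test_function \<phi> \<longleftrightarrow> (\<forall>k. Ck k \<phi>) \<and> compact (closure {x. \<phi> x \<noteq> 0})"

text \<open>Functionals are only meaningful on test functions, so distributions are compared with
  \<open>dist_eq\<close> and not with HOL equality.\<close>

type_synonym 'a distribution = "('a \<Rightarrow> complex) \<Rightarrow> complex"

definition dist_eq :: "'a::euclidean_space distribution \<Rightarrow> 'a distribution \<Rightarrow> bool" where
  "dist_eq S T \<longleftrightarrow> (\<forall>\<phi>. test_function \<phi> \<longrightarrow> S \<phi> = T \<phi>)"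

definition dist_of :: "('a::euclidean_space \<Rightarrow> complex) \<Rightarrow> 'a distribution" where
  "dist_of f = (\<lambda>\<phi>. LINT x|lebesgue. f x * \<phi> x)"

definition wirtinger_bar ::
    "'n::finite \<Rightarrow> (complex ^ 'n \<Rightarrow> complex) \<Rightarrow> complex ^ 'n \<Rightarrow> complex" where
  "wirtinger_bar k \<phi> z =
     (frechet_derivative \<phi> (at z) (axis k 1) + \<i> * frechet_derivative \<phi> (at z) (axis k \<i>)) / 2"

definition dist_dzbar ::
    "'n::finite \<Rightarrow> (complex ^ 'n) distribution \<Rightarrow> (complex ^ 'n) distribution" where
  "dist_dzbar k T = (\<lambda>\<phi>. - T (wirtinger_bar k \<phi>))"


section \<open>Forms of type \<open>(0,q)\<close>\<close>

text \<open>The coordinates are indexed by a finite linearly ordered type \<open>'n\<close>, which stands for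
  \<open>{1, \<dots>, n}\<close> with \<open>n = CARD('n)\<close>. A form is given by its coefficients: \<open>\<beta> I\<close> is the coefficient of
  the exterior product of the \<open>d zbar\<^sub>i\<close>, \<open>i \<in> I\<close>, in increasing order. A form of type \<open>(0,q)\<close> has
  zero coefficients at all \<open>I\<close> with \<open>card I \<noteq> q\<close>. A current is a form with distributions
  as coefficients.\<close>

type_synonym 'n form = "'n set \<Rightarrow> complex ^ 'n \<Rightarrow> complex"
type_synonym 'n current = "'n set \<Rightarrow> (complex ^ 'n) distribution"

definition forms :: "nat \<Rightarrow> (complex ^ 'n \<Rightarrow> complex) set \<Rightarrow> ('n::finite) form set" where
  "forms q X = {\<beta>. (\<forall>I. card I = q \<longrightarrow> \<beta> I \<in> X) \<and> (\<forall>I. card I \<noteq> q \<longrightarrow> \<beta> I = (\<lambda>_. 0))}"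

text \<open>The form whose coefficient at the product of all \<open>d zbar\<^sub>i\<close> with \<open>i \<noteq> j\<close> is \<open>w j\<close>.\<close>

definition hat_form :: "('n \<Rightarrow> complex ^ 'n \<Rightarrow> complex) \<Rightarrow> ('n::finite) form" where
  "hat_form w I z = (\<Sum>j\<in>UNIV. if I = UNIV - {j} then w j z else 0)"

definition current_of :: "('n::finite) form \<Rightarrow> 'n current" where
  "current_of \<beta> = (\<lambda>I. dist_of (\<beta> I))"

definition current_eq :: "('n::finite) current \<Rightarrow> 'n current \<Rightarrow> bool" where
  "current_eq S T \<longleftrightarrow> (\<forall>I. dist_eq (S I) (T I))"

text \<open>For \<open>k \<in> J\<close>, moving \<open>d zbar\<^sub>k\<close> from the front to its increasing-order position in the product
  over \<open>J\<close> passes one factor for each \<open>i \<in> J\<close> with \<open>i < k\<close>.\<close>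

definition dbar :: "('n::{finite,linorder}) current \<Rightarrow> 'n current" where
  "dbar T = (\<lambda>J \<phi>. \<Sum>k\<in>J. (- 1) ^ card {i \<in> J. i < k} * dist_dzbar k (T (J - {k})) \<phi>)"

end

theory Submission
  imports Defs
begin

text \<open>
  Up to signs, the coefficients of \<open>\<omega>\<close> form a vector field \<open>u\<close> with \<open>\<Sum>\<^sub>j \<partial>u\<^sub>j/\<partial>zbar\<^sub>j = 0\<close>, and the task is
  to find an antisymmetric tensor \<open>b\<close> with \<open>\<Sum>\<^sub>i \<partial>b\<^sub>i\<^sub>j/\<partial>zbar\<^sub>i = u\<^sub>j\<close>. Fix a coordinate \<open>k\<close>, let \<open>C\<close> be
  the Cauchy transform in \<open>z\<^sub>k\<close> and \<open>\<eta>\<close> a cutoff function of \<open>z\<^sub>k\<close> that is 1 on the support of \<open>u\<close>. With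
  \<open>T = \<eta> C\<close> and \<open>S = - (\<partial>\<eta>/\<partial>zbar) C\<close> one has \<open>T (\<partial>f/\<partial>zbar\<^sub>k) = f\<close> and \<open>\<partial>(T f)/\<partial>zbar\<^sub>k = f - S f\<close>, and both
  operators commute with the other derivatives and preserve \<open>L\<^sup>r\<close> and compact support in the polydisc.
  Then \<open>b\<^sub>k\<^sub>j = T u\<^sub>j = - b\<^sub>j\<^sub>k\<close> solves the equation up to the field \<open>u'\<close> with \<open>u'\<^sub>k = 0\<close> and \<open>u'\<^sub>j = S u\<^sub>j\<close>,
  which is again divergence free. As \<open>S 0 = 0\<close>, doing this for every \<open>k\<close> kills all components. All
  identities are verified on test functions, through the transposes of \<open>T\<close> and \<open>S\<close>.
\<close>

text \<open>The obstacle is the support: the Cauchy transform in one variable inverts the derivative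
  with respect to zbar_k and preserves \<open>L^r\<close>, but it spreads the support in z_k beyond
  the disc. Cutting it back creates the error S. This error does no harm because
  \<open>S (df/dzbar_k) = - (d\<eta>/dzbar) f = 0\<close>, as \<eta> is constant near the support of
  f. Applying S to the divergence equation therefore loses its k-th term, and what remains says that
  the field u' is divergence free. Applying T instead gives the k-th component of the equation for
  b: the sum of the \<open>d(T u_i)/dzbar_i\<close> over i other than k is
  \<open>- T (du_k/dzbar_k) = - u_k\<close>. Here \<open>du_k/dzbar_k\<close> is only a
  distribution, outside the domain of T and S; this is why each operator is accompanied by a map of
  test functions. The estimates are qualitative: they use only that the truncated kernel 1/z is
  integrable, so every r from 1 to infinity is treated in the same way.\<close>

section \<open>Calculus of the classes \<open>Ck\<close>\<close>

text \<open>Derivatives are unique, so an explicit derivative may replace the chosen one in the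
  definition of \<open>Ck\<close>. The closure properties below then follow by induction from the
  rules of differentiation.\<close>

lemma Ck_SucI:
  assumes "\<And>x. (f has_derivative f' x) (at x)" and "\<And>v. Ck k (\<lambda>x. f' x v)"
  shows "Ck (Suc k) f"
proof -
  have "frechet_derivative f (at x) = f' x" for x
    using assms(1)[of x] frechet_derivative_at by metis
  then show ?thesis using assms by (auto simp: differentiable_def)
qed

lemma Ck_SucD:
  assumes "Ck (Suc k) f"
  shows "(f has_derivative frechet_derivative f (at x)) (at x)"
    and "Ck k (\<lambda>x. frechet_derivative f (at x) v)"
  using assms by (auto simp: frechet_derivative_works[symmetric])

lemma Ck_Suc_imp_Ck: "Ck (Suc k) f \<Longrightarrow> Ck k f"
proof (induction k arbitrary: f)
  case 0
  then show ?case
    by (auto intro!: continuous_at_imp_continuous_on differentiable_imp_continuous_within)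
next
  case (Suc k)
  then show ?case by (metis Ck.simps(2))
qed

lemma Ck_imp_continuous: "Ck k f \<Longrightarrow> continuous_on UNIV f"
  by (induction k arbitrary: f) (auto intro!: continuous_at_imp_continuous_on differentiable_imp_continuous_within)

lemma Ck_const: "Ck k (\<lambda>x. c)"
proof (induction k arbitrary: c)
  case (Suc k)
  show ?case by (rule Ck_SucI[where f'="\<lambda>_ _. 0"]) (auto intro: Suc)
qed simp

lemma Ck_bounded_linear:
  assumes "bounded_linear f" shows "Ck k f"
proof (cases k)
  case 0
  then show ?thesis using assms by (simp add: linear_continuous_on)
next
  case (Suc j)
  then show ?thesis
    using Ck_SucI[of f "\<lambda>_. f"] assms Ck_const by (metis bounded_linear_imp_has_derivative)
qed

lemma Ck_add: "Ck k f \<Longrightarrow> Ck k g \<Longrightarrow> Ck k (\<lambda>x. f x + g x)"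
proof (induction k arbitrary: f g)
  case (Suc k)
  show ?case
    by (rule Ck_SucI[OF has_derivative_add[OF Ck_SucD(1)[OF Suc.prems(1)] Ck_SucD(1)[OF Suc.prems(2)]]])
      (intro Suc.IH Ck_SucD(2) Suc.prems)
qed (auto intro: continuous_intros)

lemma Ck_uminus: "Ck k f \<Longrightarrow> Ck k (\<lambda>x. - f x)"
proof (induction k arbitrary: f)
  case (Suc k)
  show ?case
    by (rule Ck_SucI[OF has_derivative_minus[OF Ck_SucD(1)[OF Suc.prems]]])
      (intro Suc.IH Ck_SucD(2) Suc.prems)
qed (auto intro: continuous_intros)

text \<open>Serves products, scalar multiples and inner products at once. The derivative is a sum of
  two terms of the same shape, in which one factor is differentiated and the other only loses an
  order of smoothness.\<close>

lemma Ck_bounded_bilinear: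
  assumes B: "bounded_bilinear B"
  shows "Ck k f \<Longrightarrow> Ck k g \<Longrightarrow> Ck k (\<lambda>x. B (f x) (g x))"
proof (induction k arbitrary: f g)
  case 0
  then show ?case using bounded_bilinear.continuous_on[OF B] by auto
next
  case (Suc k)
  show ?case
    by (rule Ck_SucI[OF bounded_bilinear.FDERIV[OF B Ck_SucD(1)[OF Suc.prems(1)] Ck_SucD(1)[OF Suc.prems(2)]]])
      (intro Ck_add Suc.IH Ck_SucD(2) Suc.prems Ck_Suc_imp_Ck)
qed

lemmas Ck_mult = Ck_bounded_bilinear[OF bounded_bilinear_mult]

lemma Ck_compose_bounded_linear:
  assumes L: "bounded_linear L"
  shows "Ck k f \<Longrightarrow> Ck k (\<lambda>x. f (c + L x))"
proof (induction k arbitrary: f)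
  case 0
  then show ?case
    by (auto intro!: continuous_intros continuous_on_compose2[of UNIV f] linear_continuous_on[OF L])
next
  case (Suc k)
  have L': "((\<lambda>x. c + L x) has_derivative L) (at x)" for x
    using has_derivative_add[OF has_derivative_const bounded_linear_imp_has_derivative[OF L]] by simp
  show ?case
    by (rule Ck_SucI[OF has_derivative_compose[OF L' Ck_SucD(1)[OF Suc.prems]]])
      (intro Suc.IH Ck_SucD(2) Suc.prems)
qed

text \<open>The derivative is \<open>- (1/f) * f' * (1/f)\<close>, so its smoothness to order
  \<open>k\<close> needs only that of \<open>1/f\<close> to the same order, which is the induction
  hypothesis.\<close>

lemma Ck_inverse:
  fixes f :: "'a::euclidean_space \<Rightarrow> real"
  assumes "\<And>x. f x \<noteq> 0"
  shows "Ck k f \<Longrightarrow> Ck k (\<lambda>x. inverse (f x))"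
proof (induction k)
  case 0
  then show ?case using assms by (auto intro!: continuous_intros)
next
  case (Suc k)
  note inv = Suc.IH[OF Ck_Suc_imp_Ck[OF Suc.prems]]
  show ?case
    by (rule Ck_SucI[OF Deriv.has_derivative_inverse[OF assms Ck_SucD(1)[OF Suc.prems]]])
      (intro Ck_uminus Ck_mult inv Ck_SucD(2)[OF Suc.prems])
qed

subsection \<open>Cutoff functions\<close>

text \<open>The classical flat function \<open>exp (-1/x)\<close> times powers of
  \<open>1/x\<close>. The powers make the span of the family closed under differentiation, so that
  smoothness can be proved for all \<open>j\<close> together.\<close>

definition flat :: "nat \<Rightarrow> real \<Rightarrow> real" where
  "flat j x = (if x \<le> 0 then 0 else inverse x ^ j * exp (- inverse x))"

lemma flat_tendsto_0: "(flat j \<longlongrightarrow> 0) (at 0)"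
proof -
  have "(flat j \<longlongrightarrow> 0) (at_left 0)"
    by (rule tendsto_eventually) (auto simp: flat_def eventually_at_filter)
  moreover have "(flat j \<longlongrightarrow> 0) (at_right 0)"
  proof -
    have "((\<lambda>x::real. x ^ j / exp x) \<longlongrightarrow> 0) at_top" by (rule tendsto_power_div_exp_0)
    from filterlim_compose[OF this filterlim_inverse_at_top_right]
    have "((\<lambda>x::real. inverse x ^ j / exp (inverse x)) \<longlongrightarrow> 0) (at_right 0)" .
    then show ?thesis
      by (rule Lim_transform_eventually)
        (auto simp: flat_def eventually_at_filter exp_minus field_simps)
  qed
  ultimately show ?thesis by (simp add: filterlim_split_at)
qed

lemma flat_has_real_derivative:
  "(flat j has_real_derivative flat (j + 2) x - of_nat j * flat (Suc j) x) (at x)"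
proof -
  consider "x < 0" | "x = 0" | "x > 0" by linarith
  then show ?thesis
  proof cases
    case 1
    have "((\<lambda>_. 0) has_real_derivative 0) (at x)" by simp
    then have "(flat j has_real_derivative 0) (at x)"
      by (rule has_field_derivative_transform_within[of _ _ _ _ "-x"])
         (use 1 in \<open>auto simp: flat_def dist_real_def\<close>)
    then show ?thesis using 1 by (simp add: flat_def)
  next
    case 2
    \<comment> \<open>At 0 the difference quotient of \<open>flat j\<close> is
      \<open>flat (Suc j)\<close> itself, so its limit is already known.\<close>
    have "((\<lambda>h. flat (Suc j) h) \<longlongrightarrow> 0) (at 0)" by (rule flat_tendsto_0)
    then have "((\<lambda>h. (flat j (0 + h) - flat j 0) / h) \<longlongrightarrow> 0) (at 0)"
      by (rule Lim_transform_eventually) (auto simp: flat_def eventually_at_filter field_simps)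
    then show ?thesis using 2 by (simp add: flat_def DERIV_def)
  next
    case 3
    have "((\<lambda>x. inverse x ^ j * exp (- inverse x)) has_real_derivative
        of_nat j * (- (inverse x)\<^sup>2 * inverse x ^ (j - Suc 0)) * exp (- inverse x)
        + exp (- inverse x) * (inverse x)\<^sup>2 * inverse x ^ j) (at x)"
      using 3 by (auto intro!: derivative_eq_intros simp: power2_eq_square)
    also have "of_nat j * (- (inverse x)\<^sup>2 * inverse x ^ (j - Suc 0)) * exp (- inverse x)
        + exp (- inverse x) * (inverse x)\<^sup>2 * inverse x ^ j = flat (j + 2) x - of_nat j * flat (Suc j) x"
      using 3 by (cases j) (auto simp: flat_def power2_eq_square algebra_simps)
    finally have "((\<lambda>x. inverse x ^ j * exp (- inverse x)) has_real_derivative 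
        flat (j + 2) x - of_nat j * flat (Suc j) x) (at x)" .
    then show ?thesis
      by (rule has_field_derivative_transform_within[of _ _ _ _ x])
         (use 3 in \<open>auto simp: flat_def dist_real_def\<close>)
  qed
qed

lemma Ck_flat_compose:
  fixes q :: "'a::euclidean_space \<Rightarrow> real"
  assumes "\<And>k. Ck k q"
  shows "Ck k (\<lambda>x. flat j (q x))"
proof (induction k arbitrary: j)
  case 0
  have "isCont (flat j) x" for x using flat_has_real_derivative DERIV_isCont by blast
  then show ?case using assms[of 0]
    by (auto intro: continuous_on_compose2[of UNIV "flat j" UNIV q] continuous_at_imp_continuous_on)
next
  case (Suc k)
  have q: "(q has_derivative frechet_derivative q (at x)) (at x)" for x
    by (rule Ck_SucD(1)[OF assms])
  have "((\<lambda>x. flat j (q x)) has_derivative 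
     (\<lambda>v. (flat (j + 2) (q x) + (- of_nat j) * flat (Suc j) (q x)) * frechet_derivative q (at x) v)) (at x)" for x
    using has_derivative_compose[OF q flat_has_real_derivative[unfolded has_field_derivative_def]]
    by simp
  then show ?case
    by (rule Ck_SucI) (intro Ck_mult Ck_add Ck_const Suc.IH Ck_SucD(2)[OF assms])
qed

text \<open>The usual quotient \<open>p / (p + p')\<close>, where \<open>p\<close> is positive
  exactly inside radius \<sigma> and \<open>p'\<close> exactly outside radius \<rho>. The two
  regions cover the space, so the denominator never vanishes. Squared norms are used because the
  norm is not smooth at 0.\<close>

lemma exists_cutoff:
  fixes \<rho> :: real
  assumes "0 \<le> \<rho>" "\<rho> < \<sigma>"
  obtains \<eta> :: "'a::euclidean_space \<Rightarrow> complex"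
  where "\<And>k. Ck k \<eta>" "\<And>x. norm x \<le> \<rho> \<Longrightarrow> \<eta> x = 1" "\<And>x. norm x \<ge> \<sigma> \<Longrightarrow> \<eta> x = 0"
proof -
  have sq: "Ck k (\<lambda>x::'a. x \<bullet> x)" for k
    by (rule Ck_bounded_bilinear[OF bounded_bilinear_inner]) (rule Ck_bounded_linear[OF bounded_linear_ident])+
  have q: "Ck k (\<lambda>x::'a. a + c * (x \<bullet> x))" for k a c
    by (intro Ck_add Ck_mult Ck_const sq)
  define p where "p x = flat 0 (\<sigma>\<^sup>2 + (-1) * (x \<bullet> x))" for x :: 'a
  define d where "d x = p x + flat 0 (- \<rho>\<^sup>2 + 1 * (x \<bullet> x))" for x :: 'a
  have Ckp: "Ck k p" for k unfolding p_def by (intro Ck_flat_compose q)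
  have Ckd: "Ck k d" for k unfolding d_def by (intro Ck_add Ckp Ck_flat_compose q)
  have xx: "x \<bullet> x = (norm x)\<^sup>2" for x :: 'a by (simp add: power2_norm_eq_inner)
  have rs: "\<rho>\<^sup>2 < \<sigma>\<^sup>2" using assms by (intro power_strict_mono) auto
  have d0: "d x \<noteq> 0" for x
  proof -
    have "(norm x)\<^sup>2 < \<sigma>\<^sup>2 \<or> \<rho>\<^sup>2 < (norm x)\<^sup>2" using rs by linarith
    then have "d x > 0" unfolding d_def p_def xx
      by (auto simp: flat_def intro: add_pos_pos)
    then show ?thesis by simp
  qed
  have "Ck k (\<lambda>x. p x * inverse (d x))" for k by (intro Ck_mult Ckp Ck_inverse Ckd d0)
  then have "Ck k (\<lambda>x. (p x * inverse (d x)) *\<^sub>R (1::complex))" for k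
    using Ck_bounded_bilinear[OF bounded_bilinear_scaleR] Ck_const by blast
  moreover have "(p x * inverse (d x)) *\<^sub>R (1::complex) = 1" if "norm x \<le> \<rho>" for x
  proof -
    have "(norm x)\<^sup>2 \<le> \<rho>\<^sup>2" using that by (simp add: power_mono)
    then have "d x = p x" by (simp add: d_def flat_def xx)
    then show ?thesis using d0[of x] by simp
  qed
  moreover have "(p x * inverse (d x)) *\<^sub>R (1::complex) = 0" if "norm x \<ge> \<sigma>" for x
  proof -
    have "\<sigma>\<^sup>2 \<le> (norm x)\<^sup>2" using that assms by (simp add: power_mono)
    then show ?thesis by (simp add: p_def flat_def xx)
  qed
  ultimately show ?thesis using that by blast
qed

subsection \<open>Integrals along a subspace\<close>

text \<open>The sign in \<open>w + L y\<close> makes this the transpose of convolution with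
  \<open>h\<close> along the range of \<open>L\<close>.\<close>

definition smear :: "('b::euclidean_space \<Rightarrow> complex) \<Rightarrow> ('b \<Rightarrow> 'a::euclidean_space) \<Rightarrow> ('a \<Rightarrow> complex) \<Rightarrow> 'a \<Rightarrow> complex"
  where "smear h L \<psi> w = (LINT y|lborel. h y * \<psi> (w + L y))"

text \<open>In the main application \<open>L\<close> embeds the complex line of one coordinate and
  \<open>h\<close> is the truncated Cauchy kernel. With the identity for \<open>L\<close> and an
  indicator function for \<open>h\<close>, the same lemmas yield facts about ordinary integrals. The
  bounded support of \<open>h\<close> lets arbitrary continuous functions be integrated against
  it.\<close>

locale smearing =
  fixes h :: "'b::euclidean_space \<Rightarrow> complex" and L :: "'b \<Rightarrow> 'a::euclidean_space" and R :: real
  assumes integrable: "integrable lborel h"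
    and support: "\<And>y. h y \<noteq> 0 \<Longrightarrow> norm y \<le> R"
    and linear: "bounded_linear L"
begin

lemma measurable_h [measurable]: "h \<in> borel_measurable borel"
  using borel_measurable_integrable[OF integrable] by simp

lemma continuous_L: "continuous_on S L"
  by (rule linear_continuous_on[OF linear])

lemma measurable_L [measurable]: "L \<in> borel_measurable borel"
  by (intro borel_measurable_continuous_onI continuous_L)

lemma bound_L: obtains B where "B \<ge> 0" "\<And>y. h y \<noteq> 0 \<Longrightarrow> norm (L y) \<le> B"
proof -
  obtain K where K: "\<And>y. norm (L y) \<le> norm y * K" "K \<ge> 0"
    using bounded_linear.nonneg_bounded[OF linear] by auto
  have "norm (L y) \<le> \<bar>R\<bar> * K" if "h y \<noteq> 0" for y
    using K(1)[of y] mult_right_mono[OF _ K(2), of "norm y" "\<bar>R\<bar>"] support[OF that] by linarith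
  then show ?thesis using that[of "\<bar>R\<bar> * K"] K(2) by simp
qed

lemma integrable_smear:
  assumes "continuous_on UNIV g"
  shows "integrable lborel (\<lambda>y. h y * g (w + L y))"
proof -
  obtain B where B: "B \<ge> 0" "\<And>y. h y \<noteq> 0 \<Longrightarrow> norm (L y) \<le> B" using bound_L by blast
  have "compact (g ` cball w B)"
    by (intro compact_continuous_image continuous_on_subset[OF assms]) auto
  then obtain M where M: "\<And>x. x \<in> cball w B \<Longrightarrow> norm (g x) \<le> M"
    by (meson bounded_iff compact_imp_bounded imageI)
  have [measurable]: "g \<in> borel_measurable borel"
    by (rule borel_measurable_continuous_onI[OF assms])
  show ?thesis
  proof (rule Bochner_Integration.integrable_bound)
    show "integrable lborel (\<lambda>y. M * norm (h y))"
      using integrable by simp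
    show "AE y in lborel. norm (h y * g (w + L y)) \<le> norm (M * norm (h y))"
    proof (intro AE_I2)
      fix y
      show "norm (h y * g (w + L y)) \<le> norm (M * norm (h y))"
      proof (cases "h y = 0")
        case False
        then have "w + L y \<in> cball w B" using B by (simp add: dist_norm)
        from M[OF this] show ?thesis
          using mult_right_mono[of "norm (g (w + L y))" "\<bar>M\<bar>" "norm (h y)"]
          by (simp add: norm_mult mult.commute[of "norm (h y)"] abs_mult)
      qed simp
    qed
  qed simp
qed

lemma smear_bound:
  assumes g: "continuous_on UNIV g" and e: "\<And>y. h y \<noteq> 0 \<Longrightarrow> norm (g (w + L y)) \<le> e" "e \<ge> 0"
  shows "norm (smear h L g w) \<le> e * (LINT y|lborel. norm (h y))"
proof -
  have "norm (smear h L g w) \<le> (LINT y|lborel. norm (h y * g (w + L y)))"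
    unfolding smear_def by (rule integral_norm_bound)
  also have "\<dots> \<le> (LINT y|lborel. e * norm (h y))"
  proof (rule integral_mono)
    show "norm (h y * g (w + L y)) \<le> e * norm (h y)" for y
      using e(1)[of y] by (cases "h y = 0") (auto simp: norm_mult mult.commute intro: mult_right_mono)
  qed (use integrable_norm[OF integrable_smear[OF g]] integrable in auto)
  finally show ?thesis by simp
qed

text \<open>Differentiation under the integral sign. The remainder of the smeared function is the
  smear of the first order remainder \<open>g\<close> of \<psi>, and this is small uniformly on the
  compact set that the kernel can reach, by the mean value inequality and uniform continuity of the
  derivative.\<close>

lemma smear_has_derivative:
  assumes "Ck (Suc 0) \<psi>"
  shows "(smear h L \<psi> has_derivative (\<lambda>v. smear h L (\<lambda>x. frechet_derivative \<psi> (at x) v) w)) (at w)"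
proof -
  define D where "D x = frechet_derivative \<psi> (at x)" for x
  have D: "(\<psi> has_derivative D x) (at x)" for x
    unfolding D_def by (rule Ck_SucD(1)[OF assms])
  have bD: "bounded_linear (D x)" for x by (rule has_derivative_bounded_linear[OF D])
  have cD: "continuous_on UNIV (\<lambda>x. D x v)" for v
    using Ck_SucD(2)[OF assms] by (simp add: D_def)
  have c\<psi>: "continuous_on UNIV \<psi>" by (rule Ck_imp_continuous[OF assms])
  define D' where "D' x = Blinfun (D x)" for x
  have D'[simp]: "blinfun_apply (D' x) = D x" for x
    unfolding D'_def by (rule bounded_linear_Blinfun_apply[OF bD])
  \<comment> \<open>In finite dimension, continuity in every direction gives continuity in operator
    norm, which the uniform estimate needs.\<close>
  have cD': "continuous_on UNIV D'"
    by (rule continuous_on_blinfun_componentwise) (simp add: cD)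
  obtain B where B: "B \<ge> 0" "\<And>y. h y \<noteq> 0 \<Longrightarrow> norm (L y) \<le> B" using bound_L by blast
  define N where "N = (LINT y|lborel. norm (h y))"
  have N0: "N \<ge> 0" unfolding N_def by simp
  have lin: "linear (\<lambda>v. smear h L (\<lambda>x. D x v) w)"
  proof (rule linearI)
    fix a b and c :: real
    have "smear h L (\<lambda>x. D x (a + b)) w = (LINT y|lborel. h y * D (w + L y) a + h y * D (w + L y) b)"
      unfolding smear_def by (simp add: linear_add[OF bounded_linear.linear[OF bD]] distrib_left)
    then show "smear h L (\<lambda>x. D x (a + b)) w = smear h L (\<lambda>x. D x a) w + smear h L (\<lambda>x. D x b) w"
      unfolding smear_def
      by (simp add: Bochner_Integration.integral_add[OF integrable_smear[OF cD] integrable_smear[OF cD]])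
    have "smear h L (\<lambda>x. D x (c *\<^sub>R a)) w = (LINT y|lborel. c *\<^sub>R (h y * D (w + L y) a))"
      unfolding smear_def by (simp add: linear_scale[OF bounded_linear.linear[OF bD]])
    then show "smear h L (\<lambda>x. D x (c *\<^sub>R a)) w = c *\<^sub>R smear h L (\<lambda>x. D x a) w"
      unfolding smear_def by simp
  qed
  show ?thesis
    unfolding D_def[symmetric] has_derivative_at_alt
  proof (intro conjI allI impI)
    show "bounded_linear (\<lambda>v. smear h L (\<lambda>x. D x v) w)"
      by (rule linear_conv_bounded_linear[THEN iffD1, OF lin])
    fix e :: real assume e: "e > 0"
    \<comment> \<open>The summand 1 avoids a division by zero when the kernel vanishes almost
      everywhere.\<close>
    define e' where "e' = e / (N + 1)"
    have e': "e' > 0" "e' * N \<le> e" using e N0 by (auto simp: e'_def field_simps)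
    \<comment> \<open>Points \<open>w + L y\<close> with \<open>h y \<noteq> 0\<close> are within
      \<open>B\<close> of \<open>w\<close>; the extra 1 leaves room for the increment
      \<open>z - w\<close>, hence the bound \<open>min d 1\<close> below.\<close>
    define C where "C = cball w (B + 1)"
    have "uniformly_continuous_on C D'"
      unfolding C_def by (intro compact_uniformly_continuous continuous_on_subset[OF cD']) auto
    then obtain d where d: "d > 0" "\<And>x y. x \<in> C \<Longrightarrow> y \<in> C \<Longrightarrow> dist y x < d \<Longrightarrow> dist (D' y) (D' x) < e'"
      using e'(1) unfolding uniformly_continuous_on_def by metis
    show "\<exists>d>0. \<forall>z. norm (z - w) < d \<longrightarrow>
        norm (smear h L \<psi> z - smear h L \<psi> w - smear h L (\<lambda>x. D x (z - w)) w) \<le> e * norm (z - w)"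
    proof (intro exI[of _ "min d 1"] conjI allI impI)
      show "min d 1 > 0" using d by simp
      fix z assume z: "norm (z - w) < min d 1"
      define g where "g x = \<psi> (x + (z - w)) - \<psi> x - D x (z - w)" for x
      have cg: "continuous_on UNIV g" unfolding g_def
        by (intro continuous_on_diff cD c\<psi> continuous_on_compose2[OF c\<psi>] continuous_on_add
          continuous_on_id continuous_on_const) auto
      have "smear h L \<psi> z - smear h L \<psi> w - smear h L (\<lambda>x. D x (z - w)) w = smear h L g w"
      proof -
        have "smear h L g w = (LINT y|lborel. (h y * \<psi> (z + L y) - h y * \<psi> (w + L y)) - h y * D (w + L y) (z - w))"
          unfolding smear_def g_def by (intro Bochner_Integration.integral_cong) (auto simp: algebra_simps)
        also have "\<dots> = (LINT y|lborel. (h y * \<psi> (z + L y) - h y * \<psi> (w + L y))) - (LINT y|lborel. h y * D (w + L y) (z - w))"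
          by (intro Bochner_Integration.integral_diff Bochner_Integration.integrable_diff integrable_smear c\<psi> cD)
        also have "(LINT y|lborel. (h y * \<psi> (z + L y) - h y * \<psi> (w + L y))) = smear h L \<psi> z - smear h L \<psi> w"
          unfolding smear_def
          by (intro Bochner_Integration.integral_diff integrable_smear c\<psi>)
        finally show ?thesis by (simp add: smear_def)
      qed
      also have "norm \<dots> \<le> (norm (z - w) * e') * (LINT y|lborel. norm (h y))"
      proof (rule smear_bound[OF cg])
        fix y assume y: "h y \<noteq> 0"
        define x0 where "x0 = w + L y"
        have x0: "dist w x0 \<le> B" using B(2)[OF y] by (simp add: x0_def dist_norm)
        define S where "S = ball x0 (min d 1)"
        have SC: "S \<subseteq> C"
        proof
          fix x assume "x \<in> S"
          then show "x \<in> C" using x0 dist_triangle[of w x x0] by (simp add: S_def C_def)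
        qed
        have "norm (\<psi> (x0 + (z - w)) - \<psi> x0 - D x0 ((x0 + (z - w)) - x0)) \<le> norm ((x0 + (z - w)) - x0) * e'"
        proof (rule differentiable_bound_linearization[where S = S and f' = D])
          fix t :: real assume t: "t \<in> {0..1}"
          have "\<bar>t\<bar> * norm (z - w) \<le> norm (z - w)" using t by (simp add: mult_left_le_one_le)
          then show "x0 + t *\<^sub>R (x0 + (z - w) - x0) \<in> S" using z by (simp add: S_def dist_norm)
        next
          fix x assume x: "x \<in> S"
          show "(\<psi> has_derivative D x) (at x within S)" by (rule has_derivative_at_withinI[OF D])
          have "dist x x0 < d" using x by (simp add: S_def dist_commute)
          then have "dist (D' x) (D' x0) < e'"
            using d(2)[OF subsetD[OF SC] subsetD[OF SC x]] z d(1)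
          by (simp add: S_def)
          moreover have "dist (D' x) (D' x0) = onorm (D x - D x0)"
            by (simp add: dist_norm norm_blinfun.rep_eq minus_blinfun.rep_eq fun_diff_def)
          ultimately show "onorm (D x - D x0) \<le> e'" by simp
        qed (use d in \<open>simp add: S_def\<close>)
        then show "norm (g (w + L y)) \<le> norm (z - w) * e'"
          by (simp add: g_def x0_def)
      qed (use e' in simp)
      also have "\<dots> = norm (z - w) * (e' * N)" by (simp add: N_def)
      also have "\<dots> \<le> e * norm (z - w)" using mult_left_mono[OF e'(2), of "norm (z - w)"] by (simp add: mult.commute)
      finally show "norm (smear h L \<psi> z - smear h L \<psi> w - smear h L (\<lambda>x. D x (z - w)) w) \<le> e * norm (z - w)" .
    qed
  qed
qed

lemma frechet_derivative_smear:
  "Ck (Suc 0) \<psi> \<Longrightarrow> frechet_derivative (smear h L \<psi>) (at w) v = smear h L (\<lambda>x. frechet_derivative \<psi> (at x) v) w"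
  by (simp add: frechet_derivative_at[OF smear_has_derivative, symmetric])

lemma continuous_smear:
  assumes c: "continuous_on UNIV \<psi>"
  shows "continuous_on UNIV (smear h L \<psi>)"
proof (clarsimp simp: continuous_on_iff)
  fix w and e :: real assume e: "e > 0"
  obtain B where B: "B \<ge> 0" "\<And>y. h y \<noteq> 0 \<Longrightarrow> norm (L y) \<le> B" using bound_L by blast
  define N where "N = (LINT y|lborel. norm (h y))"
  have N0: "N \<ge> 0" unfolding N_def by simp
  define e' where "e' = e / (N + 1)"
  have e': "e' > 0" "e' * N < e" using e N0 by (auto simp: e'_def field_simps)
  have "uniformly_continuous_on (cball w (B + 1)) \<psi>"
    by (intro compact_uniformly_continuous continuous_on_subset[OF c]) auto
  then obtain d where d: "d > 0" "\<And>x y. x \<in> cball w (B + 1) \<Longrightarrow> y \<in> cball w (B + 1) \<Longrightarrow> dist y x < d \<Longrightarrow> dist (\<psi> y) (\<psi> x) < e'"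
    using e'(1) unfolding uniformly_continuous_on_def by metis
  show "\<exists>d>0. \<forall>x'. dist x' w < d \<longrightarrow> dist (smear h L \<psi> x') (smear h L \<psi> w) < e"
  proof (intro exI[of _ "min d 1"] conjI allI impI)
    fix z assume z: "dist z w < min d 1"
    have cg: "continuous_on UNIV (\<lambda>x. \<psi> (x + (z - w)) - \<psi> x)"
      by (intro continuous_on_diff c continuous_on_compose2[OF c] continuous_on_add continuous_on_id continuous_on_const) auto
    have "smear h L \<psi> z - smear h L \<psi> w = smear h L (\<lambda>x. \<psi> (x + (z - w)) - \<psi> x) w"
    proof -
      have "(LINT y|lborel. (h y * \<psi> (z + L y) - h y * \<psi> (w + L y))) = smear h L \<psi> z - smear h L \<psi> w"
          unfolding smear_def
          by (intro Bochner_Integration.integral_diff integrable_smear c)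
      then show ?thesis unfolding smear_def by (simp add: algebra_simps)
    qed
    also have "norm \<dots> \<le> e' * N"
      unfolding N_def
    proof (rule smear_bound[OF cg])
      fix y assume y: "h y \<noteq> 0"
      have "w + L y \<in> cball w (B + 1)" using B(2)[OF y] by (simp add: dist_norm)
      moreover have "w + L y + (z - w) \<in> cball w (B + 1)"
        using B(2)[OF y] z norm_triangle_ineq[of "L y" "z - w"] norm_minus_commute[of w "z + L y"]
        by (simp add: dist_norm add.commute add_diff_eq)
      moreover have "dist (w + L y + (z - w)) (w + L y) < d" using z by (simp add: dist_norm algebra_simps)
      ultimately show "norm (\<psi> (w + L y + (z - w)) - \<psi> (w + L y)) \<le> e'"
        using d(2)[of "w + L y" "w + L y + (z - w)"] by (simp add: dist_norm)
    qed (use e' in simp)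
    finally show "dist (smear h L \<psi> z) (smear h L \<psi> w) < e" using e' by (simp add: dist_norm)
  qed (use d in simp)
qed

lemma Ck_smear: "Ck k \<psi> \<Longrightarrow> Ck k (smear h L \<psi>)"
proof (induction k arbitrary: \<psi>)
  case 0
  then show ?case using continuous_smear by simp
next
  case (Suc k)
  have "Ck (Suc 0) \<psi>"
    using Suc.prems Ck_imp_continuous by (auto simp: Ck.simps(2))
  from smear_has_derivative[OF this]
  show ?case by (rule Ck_SucI) (intro Suc.IH Ck_SucD(2)[OF Suc.prems])
qed

end

subsection \<open>The Cauchy kernel\<close>

lemma integral_translate:
  fixes f :: "'a::euclidean_space \<Rightarrow> complex"
  assumes [measurable]: "f \<in> borel_measurable borel"
  shows "(LINT x|lborel. f (c + x)) = (LINT x|lborel. f x)"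
proof -
  have "(LINT x|distr lborel borel ((+) c). f x) = (LINT x|lborel. f (c + x))"
    by (rule integral_distr) auto
  then show ?thesis by (simp add: lborel_distr_plus)
qed

lemma smearing_indicator: "smearing (indicator (cball 0 R)) (\<lambda>x. x) R"
proof (rule smearing.intro)
  have "integrable lborel (\<lambda>x::'a. complex_of_real (indicator (cball 0 R) x))"
    by (intro integrable_of_real integrable_real_indicator emeasure_lborel_cball_finite) simp
  moreover have "(\<lambda>x::'a. complex_of_real (indicator (cball 0 R) x)) = indicator (cball 0 R)"
    by (auto simp: indicator_def)
  ultimately show "integrable lborel (indicator (cball 0 R) :: 'a \<Rightarrow> complex)" by simp
qed (auto simp: indicator_def bounded_linear_ident split: if_splits)

lemma integrable_continuous_bounded_support:
  fixes g :: "'a::euclidean_space \<Rightarrow> complex"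
  assumes "continuous_on UNIV g" "\<And>x. norm x > R \<Longrightarrow> g x = 0"
  shows "integrable lborel g"
proof -
  interpret smearing "indicator (cball 0 R)" "\<lambda>x. x" R by (rule smearing_indicator)
  have "integrable lborel (\<lambda>y. indicator (cball 0 R) y * g (0 + y))"
    by (rule integrable_smear[OF assms(1)])
  also have "(\<lambda>y. indicator (cball 0 R) y * g (0 + y)) = g"
    using assms(2) by (intro ext) (simp add: indicator_def, meson linorder_not_le)
  finally show ?thesis .
qed

lemma frechet_derivative_eq_0_outside:
  assumes "\<And>x. norm x > R \<Longrightarrow> g x = 0" "norm x > R"
  shows "frechet_derivative g (at x) = (\<lambda>v. 0)"
proof -
  have "((\<lambda>_. 0) has_derivative (\<lambda>_. 0)) (at x)" by simp
  then have "(g has_derivative (\<lambda>_. 0)) (at x)"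
    by (rule has_derivative_transform_within_open[of _ _ _ _ "- cball 0 R"]) (use assms in auto)
  then show ?thesis by (rule frechet_derivative_at[symmetric])
qed

text \<open>The integral of a translate of \<open>g\<close> does not depend on the translation.
  Differentiating this constant under the integral sign gives the integral of the
  derivative.\<close>

lemma integral_frechet_derivative_eq_0:
  fixes g :: "'a::euclidean_space \<Rightarrow> complex"
  assumes g: "Ck (Suc 0) g" and R: "\<And>x. norm x > R \<Longrightarrow> g x = 0"
  shows "(LINT x|lborel. frechet_derivative g (at x) v) = 0"
proof -
  \<comment> \<open>Radius \<open>R + 1\<close> contains the supports of all translates by vectors
    of norm less than 1, so the indicator does not alter their integrals.\<close>
  interpret smearing "indicator (cball 0 (R + 1))" "\<lambda>x. x" "R + 1" by (rule smearing_indicator)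
  let ?S = "smear (indicator (cball 0 (R + 1))) (\<lambda>x. x)"
  have cg: "continuous_on UNIV g" by (rule Ck_imp_continuous[OF g])
  then have [measurable]: "g \<in> borel_measurable borel" by (rule borel_measurable_continuous_onI)
  have const: "?S g w = (LINT x|lborel. g x)" if "w \<in> ball 0 1" for w
  proof -
    have "indicator (cball 0 (R + 1)) y * g (w + y) = g (w + y)" for y
    proof (cases "norm (w + y) > R")
      case False
      then have "norm y \<le> R + 1" using that norm_triangle_ineq4[of "w + y" w] by simp
      then show ?thesis by simp
    qed (simp add: R)
    then have "?S g w = (LINT y|lborel. g (w + y))" unfolding smear_def by (simp only:)
    also have "(LINT y|lborel. g (w + y)) = (LINT x|lborel. g x)"
      using \<open>g \<in> borel_measurable borel\<close> by (rule integral_translate)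
    finally show ?thesis .
  qed
  have "((\<lambda>_. LINT x|lborel. g x) has_derivative (\<lambda>_. 0)) (at 0)" by simp
  then have "(?S g has_derivative (\<lambda>_. 0)) (at 0)"
    by (rule has_derivative_transform_within_open[of _ _ _ _ "ball 0 1"]) (use const in auto)
  from has_derivative_unique[OF this smear_has_derivative[OF g]]
  have "?S (\<lambda>x. frechet_derivative g (at x) v) 0 = 0" by (rule fun_cong[symmetric])
  moreover have "indicator (cball 0 (R + 1)) y * frechet_derivative g (at y) v = frechet_derivative g (at y) v" for y
    using frechet_derivative_eq_0_outside[of R g y, OF R] by (cases "norm y > R") auto
  ultimately show ?thesis unfolding smear_def by simp
qed

text \<open>A substitute for polar coordinates: the function is dominated by a series of constants
  on discs, and the area of a disc is a multiple of its squared radius. It is applied to the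
  singularity of 1/z at 0 and to the decay of \<open>bubble\<close> at infinity.\<close>

lemma nn_integral_complex_dyadic:
  fixes f :: "complex \<Rightarrow> ennreal"
  assumes f: "\<And>z. f z \<noteq> 0 \<Longrightarrow> \<exists>n. norm z \<le> s n \<and> f z \<le> ennreal (a n)"
    and nonneg: "\<And>n. s n \<ge> 0" "\<And>n. a n \<ge> 0" and sum: "summable (\<lambda>n. a n * (s n)\<^sup>2)"
  shows "(\<integral>\<^sup>+ z. f z \<partial>lborel) < \<infinity>"
proof -
  have "(\<integral>\<^sup>+ z. f z \<partial>lborel) \<le> (\<integral>\<^sup>+ z. (\<Sum>n. ennreal (a n) * indicator (cball 0 (s n)) (z::complex)) \<partial>lborel)"
  proof (rule nn_integral_mono)
    fix z
    show "f z \<le> (\<Sum>n. ennreal (a n) * indicator (cball 0 (s n)) z)"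
    proof (cases "f z = 0")
      case False
      then obtain n where n: "norm z \<le> s n" "f z \<le> ennreal (a n)" using f by blast
      define F where "F n = ennreal (a n) * indicator (cball 0 (s n)) z" for n
      have "sum F {n} \<le> suminf F" by (rule sum_le_suminf) auto
      then have "F n \<le> suminf F" by simp
      then have "ennreal (a n) * indicator (cball 0 (s n)) z \<le> (\<Sum>n. ennreal (a n) * indicator (cball 0 (s n)) z)"
        unfolding F_def[abs_def] .
      then show ?thesis using n by simp
    qed simp
  qed
  also have "\<dots> = (\<Sum>n. \<integral>\<^sup>+ z. ennreal (a n) * indicator (cball 0 (s n)) (z::complex) \<partial>lborel)"
    by (intro nn_integral_suminf borel_measurable_times_ennreal borel_measurable_indicator) auto
  also have "\<dots> = (\<Sum>n. ennreal (unit_ball_vol 2 * (a n * (s n)\<^sup>2)))"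
    using nonneg by (simp add: nn_integral_cmult_indicator emeasure_cball ennreal_mult[symmetric] mult_ac)
  also have "\<dots> = ennreal (\<Sum>n. unit_ball_vol 2 * (a n * (s n)\<^sup>2))"
    by (rule suminf_ennreal2) (use nonneg sum in \<open>auto intro!: summable_mult mult_nonneg_nonneg\<close>)
  finally show ?thesis by (simp add: top.not_eq_extremum order_le_less_trans[OF _ ennreal_less_top])
qed

lemma integrable_inverse_cball:
  "integrable lborel (\<lambda>z::complex. indicator (cball 0 2) z * inverse z)"
proof (rule integrableI_bounded)
  show "(\<integral>\<^sup>+ z. ennreal (norm (indicator (cball 0 2) (z::complex) * inverse z)) \<partial>lborel) < \<infinity>"
  proof (rule nn_integral_complex_dyadic[where s = "\<lambda>n. 2 * (1/2) ^ n" and a = "\<lambda>n. 2 ^ n"])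
    fix z :: complex
    assume "ennreal (norm (indicator (cball 0 2) z * inverse z)) \<noteq> 0"
    then have z: "z \<noteq> 0" "norm z \<le> 2" by (auto simp: indicator_def)
    \<comment> \<open>By minimality the norm lies between \<open>(1/2)^n\<close> and twice this
      value; for \<open>n = 0\<close> the upper bound 2 comes from the truncation. The resulting
      series has terms \<open>4 * (1/2)^n\<close>.\<close>
    define n where "n = (LEAST n. (1/2) ^ n < norm z)"
    have ex: "\<exists>n. (1/2) ^ n < norm z" using z real_arch_pow_inv[of "norm z" "1/2"] by simp
    have n: "(1/2) ^ n < norm z" unfolding n_def by (rule LeastI_ex[OF ex])
    have "norm z \<le> 2 * (1/2) ^ n"
    proof (cases n)
      case (Suc m)
      then have "\<not> (1/2) ^ m < norm z" using not_less_Least[of m "\<lambda>n. (1/2) ^ n < norm z"] n_def by simp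
      then show ?thesis using Suc by simp
    qed (use z in simp)
    moreover have "inverse (norm z) \<le> inverse ((1/2) ^ n)" by (rule le_imp_inverse_le) (use n in auto)
    then have "norm (indicator (cball 0 2) z * inverse z) \<le> 2 ^ n"
      using z by (simp add: norm_inverse power_one_over)
    ultimately show "\<exists>n. norm z \<le> 2 * (1/2) ^ n \<and> ennreal (norm (indicator (cball 0 2) z * inverse z)) \<le> ennreal (2 ^ n)"
      by (intro exI[of _ n]) (auto intro: ennreal_leI)
  next
    have "(\<lambda>n. 2 ^ n * (2 * (1/2) ^ n)\<^sup>2) = (\<lambda>n. 4 * (1/2::real) ^ n)"
      by (auto simp: power2_eq_square power_divide field_simps)
    then show "summable (\<lambda>n. 2 ^ n * (2 * (1/2::real) ^ n)\<^sup>2)"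
      by (simp add: summable_mult summable_geometric)
  qed auto
qed (auto intro!: borel_measurable_times borel_measurable_indicator)

text \<open>The derivative of \<open>cnj z / (1 + |z|^2)\<close> with respect to zbar, a positive
  integrable function whose rescalings concentrate at 0.\<close>

definition bubble :: "complex \<Rightarrow> complex" where
  "bubble z = of_real (inverse ((1 + (norm z)\<^sup>2)\<^sup>2))"

lemma measurable_bubble [measurable]: "bubble \<in> borel_measurable borel"
  unfolding bubble_def[abs_def] by measurable

lemma integrable_bubble: "integrable lborel bubble"
proof (rule integrableI_bounded)
  show "(\<integral>\<^sup>+ z. ennreal (norm (bubble z)) \<partial>lborel) < \<infinity>"
  proof (rule nn_integral_complex_dyadic[where s = "\<lambda>n. 2 ^ n" and a = "\<lambda>n. 16 * (1/16) ^ n"])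
    fix z :: complex
    \<comment> \<open>For positive \<open>n\<close> the norm exceeds \<open>2^(n-1)\<close>, and
      \<open>bubble\<close> is at most the inverse fourth power of the norm. The factor 16 pays for
      using the inner radius of the dyadic annulus.\<close>
    define n where "n = (LEAST n. norm z \<le> 2 ^ n)"
    have ex: "\<exists>n. norm z \<le> 2 ^ n" using real_arch_pow[of 2 "norm z"] less_imp_le by auto
    have n: "norm z \<le> 2 ^ n" unfolding n_def by (rule LeastI_ex[OF ex])
    have "inverse ((1 + (norm z)\<^sup>2)\<^sup>2) \<le> 16 * (1/16) ^ n"
    proof (cases n)
      case 0
      have "inverse ((1 + (norm z)\<^sup>2)\<^sup>2) \<le> inverse 1" by (rule le_imp_inverse_le) auto
      then show ?thesis using 0 by simp
    next
      case (Suc m)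
      then have "\<not> norm z \<le> 2 ^ m" using not_less_Least[of m "\<lambda>n. norm z \<le> 2 ^ n"] n_def by simp
      then have "(2 ^ m) ^ 4 \<le> norm z ^ 4" by (intro power_mono) auto
      also have "norm z ^ 4 = ((norm z)\<^sup>2)\<^sup>2" by (simp flip: power_mult)
      also have "\<dots> \<le> (1 + (norm z)\<^sup>2)\<^sup>2" by (intro power_mono) auto
      also have "(2 ^ m :: real) ^ 4 = 16 ^ m" by (simp flip: power_mult add: mult.commute[of m] power_mult[of 2 4 m])
      finally have "inverse ((1 + (norm z)\<^sup>2)\<^sup>2) \<le> inverse (16 ^ m)" by (rule le_imp_inverse_le) auto
      then show ?thesis using Suc by (simp add: power_one_over field_simps)
    qed
    then show "\<exists>n. norm z \<le> 2 ^ n \<and> ennreal (norm (bubble z)) \<le> ennreal (16 * (1/16) ^ n)"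
      using n by (intro exI[of _ n]) (auto simp: bubble_def norm_inverse norm_power simp flip: of_real_add of_real_power intro!: ennreal_leI)
  next
    have "16 * (1/16) ^ n * (2 ^ n)\<^sup>2 = 16 * (1/4::real) ^ n" for n :: nat
    proof -
      have "(2 ^ n)\<^sup>2 = (4::real) ^ n"
        using power_mult_distrib[of 2 "2::real" n] by (simp add: power2_eq_square)
      then show ?thesis using power_mult_distrib[of "1/16" "4::real" n] by simp
    qed
    then show "summable (\<lambda>n. 16 * (1/16) ^ n * (2 ^ n :: real)\<^sup>2)"
      by (simp only: summable_mult summable_geometric real_norm_def)
  qed auto
qed simp

lemma integral_bubble_nonzero: "(LINT z|lborel. bubble z) \<noteq> 0"
proof
  let ?b = "\<lambda>z::complex. inverse ((1 + (norm z)\<^sup>2)\<^sup>2)"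
  have b: "bubble = (\<lambda>z. complex_of_real (?b z))" by (auto simp: bubble_def)
  have int: "integrable lborel ?b"
    using integrable_Re[OF integrable_bubble] by (simp add: b del: of_real_inverse of_real_power of_real_add)
  assume "(LINT z|lborel. bubble z) = 0"
  then have "(LINT z|lborel. ?b z) = 0"
    unfolding b integral_complex_of_real by simp
  then have "AE z in lborel. ?b z = 0"
    using integral_nonneg_eq_0_iff_AE[OF int] by simp
  moreover have "?b z \<noteq> 0" for z
    using add_pos_nonneg[of 1 "(norm z)\<^sup>2"] by (simp add: power_eq_0_iff)
  ultimately have "AE z::complex in lborel. False" by simp
  then have "ae_filter (lborel :: complex measure) = bot" by (simp add: trivial_limit_def)
  then show False by (simp add: ae_filter_eq_bot_iff emeasure_lborel_UNIV)
qed

definition wirt :: "(complex \<Rightarrow> complex) \<Rightarrow> complex \<Rightarrow> complex" where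
  "wirt g z = (frechet_derivative g (at z) 1 + \<i> * frechet_derivative g (at z) \<i>) / 2"

lemma integral_scale:
  fixes f :: "complex \<Rightarrow> complex"
  assumes [measurable]: "f \<in> borel_measurable borel" and "e > 0"
  shows "(LINT z|lborel. f z) = (LINT z|lborel. of_real (e\<^sup>2) * f (of_real e * z))"
proof -
  have "(LINT z|lborel. f z) = (LINT z|density (distr lborel borel (\<lambda>x. 0 + e *\<^sub>R x)) (\<lambda>_. ennreal (\<bar>e\<bar> ^ DIM(complex))). f z)"
    using lborel_affine[of e "0::complex"] assms by simp
  also have "\<dots> = (LINT z|distr lborel borel (\<lambda>x. 0 + e *\<^sub>R x). (\<bar>e\<bar> ^ DIM(complex)) *\<^sub>R f z)"
    by (rule integral_density) auto
  also have "\<dots> = (LINT z|lborel. (\<bar>e\<bar> ^ DIM(complex)) *\<^sub>R f (0 + e *\<^sub>R z))"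
    by (rule integral_distr) auto
  finally show ?thesis using assms by (simp add: scaleR_conv_of_real)
qed

text \<open>\<open>cnj z / (\<bar>z\<bar>\<^sup>2 + e\<^sup>2)\<close> is a smooth approximation of \<open>1 / z\<close> whose derivative with respect to \<open>zbar\<close>
  is the approximate identity \<open>e\<^sup>2 / (\<bar>z\<bar>\<^sup>2 + e\<^sup>2)\<^sup>2\<close>, a rescaled \<open>bubble\<close>.\<close>

lemma regularized_cauchy:
  fixes g :: "complex \<Rightarrow> complex"
  assumes g: "Ck (Suc 0) g" and supp: "\<And>z. norm z > R \<Longrightarrow> g z = 0" and e: "e > 0"
  shows "(LINT z|lborel. inverse (of_real ((norm z)\<^sup>2 + e\<^sup>2)) * cnj z * wirt g z)
    = - (LINT z|lborel. bubble z * g (of_real e * z))"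
proof -
  define q where "q z = e\<^sup>2 + z \<bullet> z" for z :: complex
  have q: "q z = (norm z)\<^sup>2 + e\<^sup>2" for z by (simp add: q_def power2_norm_eq_inner)
  have q0: "q z > 0" for z using e unfolding q by (simp add: add_nonneg_pos)
  have Ckq: "Ck k q" for k unfolding q_def
    by (intro Ck_add Ck_const Ck_bounded_bilinear[OF bounded_bilinear_inner] Ck_bounded_linear bounded_linear_ident)
  define K where "K z = inverse (q z) *\<^sub>R cnj z" for z
  have CkK: "Ck k K" for k unfolding K_def[abs_def] using q0
    by (intro Ck_bounded_bilinear[OF bounded_bilinear_scaleR] Ck_inverse Ckq Ck_bounded_linear[OF bounded_linear_cnj])
      (metis less_irrefl)
  have dq: "(q has_derivative (\<lambda>v. 2 * (z \<bullet> v))) (at z)" for z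
    unfolding q_def[abs_def] by (auto intro!: derivative_eq_intros simp: inner_commute)
  have dK: "(K has_derivative (\<lambda>v. inverse (q z) *\<^sub>R cnj v + (- (inverse (q z) * (2 * (z \<bullet> v)) * inverse (q z))) *\<^sub>R cnj z)) (at z)" for z
    unfolding K_def[abs_def]
    by (rule has_derivative_scaleR[OF Deriv.has_derivative_inverse[OF _ dq] bounded_linear_imp_has_derivative[OF bounded_linear_cnj]])
      (use q0[of z] in simp)
  define F where "F z = K z * g z" for z
  have CkF: "Ck (Suc 0) F" unfolding F_def by (intro Ck_mult CkK g)
  have dg: "(g has_derivative frechet_derivative g (at z)) (at z)" for z by (rule Ck_SucD(1)[OF g])
  have dF: "frechet_derivative F (at z) v = K z * frechet_derivative g (at z) v +
    (inverse (q z) *\<^sub>R cnj v + (- (inverse (q z) * (2 * (z \<bullet> v)) * inverse (q z))) *\<^sub>R cnj z) * g z" for z v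
    unfolding F_def[abs_def]
    by (subst frechet_derivative_at[OF has_derivative_mult[OF dK dg], symmetric]) simp
  have F0: "F z = 0" if "norm z > R" for z using supp[OF that] by (simp add: F_def)
  have cF: "continuous_on UNIV (\<lambda>z. frechet_derivative F (at z) v)" for v
    using Ck_SucD(2)[OF CkF] by simp
  have iF: "integrable lborel (\<lambda>z. frechet_derivative F (at z) v)" for v
    by (rule integrable_continuous_bounded_support[OF cF, of R]) (use frechet_derivative_eq_0_outside[of R F, OF F0] in auto)
  \<comment> \<open>The derivative with respect to zbar of the compactly supported product
    \<open>F = K * g\<close> integrates to 0; the product rule splits it into the two integrals of
    the claim.\<close>
  have "0 = (LINT z|lborel. frechet_derivative F (at z) 1) + \<i> * (LINT z|lborel. frechet_derivative F (at z) \<i>)"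
    by (simp add: integral_frechet_derivative_eq_0[OF CkF F0])
  also have "\<dots> = (LINT z|lborel. frechet_derivative F (at z) 1 + \<i> * frechet_derivative F (at z) \<i>)"
    by (simp add: iF Bochner_Integration.integral_add)
  also have "\<dots> = (LINT z|lborel. 2 * (K z * wirt g z + of_real (e\<^sup>2 * inverse ((q z)\<^sup>2)) * g z))"
  proof (rule Bochner_Integration.integral_cong)
    fix z
    have K1: "K z = of_real (inverse (q z)) * cnj z" by (simp add: K_def scaleR_conv_of_real)
    \<comment> \<open>This is twice the zbar-derivative of \<open>K\<close>: since
      \<open>|z|^2 = q z - e^2\<close>, the terms of order \<open>1/q\<close> cancel and only
      \<open>e^2 / q^2\<close> is left.\<close>
    have "2 * of_real (inverse (q z)) - (of_real (inverse (q z)))\<^sup>2 * (2 * (of_real (Re z) + \<i> * of_real (Im z)) * cnj z) = 2 * of_real (e\<^sup>2 * inverse ((q z)\<^sup>2))"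
    proof -
      have "of_real (Re z) + \<i> * of_real (Im z) = z" by (simp add: complex_eq_iff)
      moreover have "z * cnj z = of_real (q z - e\<^sup>2)"
        by (simp only: complex_norm_square[symmetric] q) simp
      ultimately have "2 * of_real (inverse (q z)) - (of_real (inverse (q z)))\<^sup>2 * (2 * (of_real (Re z) + \<i> * of_real (Im z)) * cnj z) 
         = of_real (2 * inverse (q z) - (inverse (q z))\<^sup>2 * (2 * (q z - e\<^sup>2)))"
        by (simp add: mult.assoc)
      also have "2 * inverse (q z) - (inverse (q z))\<^sup>2 * (2 * (q z - e\<^sup>2)) = 2 * (e\<^sup>2 * inverse ((q z)\<^sup>2))"
        using q0[of z] by (simp add: field_simps power2_eq_square)
      finally show ?thesis by simp
    qed
    note eq = arg_cong[where f = "\<lambda>x. x * g z", OF this]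
    show "frechet_derivative F (at z) 1 + \<i> * frechet_derivative F (at z) \<i> =
      2 * (K z * wirt g z + of_real (e\<^sup>2 * inverse ((q z)\<^sup>2)) * g z)"
      unfolding distrib_left mult.assoc[symmetric] eq[unfolded mult.assoc[symmetric], symmetric] dF wirt_def
      using less_imp_neq[OF q0[of z], symmetric]
      by (simp add: scaleR_conv_of_real inner_complex_def K1 field_simps power2_eq_square)
  qed simp
  also have "\<dots> = 2 * (LINT z|lborel. K z * wirt g z + of_real (e\<^sup>2 * inverse ((q z)\<^sup>2)) * g z)"
    by (rule integral_mult_right_zero)
  also have "(LINT z|lborel. K z * wirt g z + of_real (e\<^sup>2 * inverse ((q z)\<^sup>2)) * g z)
    = (LINT z|lborel. K z * wirt g z) + (LINT z|lborel. of_real (e\<^sup>2 * inverse ((q z)\<^sup>2)) * g z)"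
  proof (rule Bochner_Integration.integral_add)
    have "continuous_on UNIV (wirt g)" unfolding wirt_def[abs_def]
      using Ck_SucD(2)[OF g] by (auto intro!: continuous_intros)
    then show "integrable lborel (\<lambda>z. K z * wirt g z)"
      by (intro integrable_continuous_bounded_support[of _ R] continuous_on_mult Ck_imp_continuous[OF CkK])
        (auto simp: wirt_def frechet_derivative_eq_0_outside[of R g, OF supp])
    show "integrable lborel (\<lambda>z. of_real (e\<^sup>2 * inverse ((q z)\<^sup>2)) * g z)"
      using q0 by (intro integrable_continuous_bounded_support[of _ R] continuous_intros Ck_imp_continuous[OF g] Ck_imp_continuous[OF Ckq])
        (auto simp: supp less_imp_neq[symmetric])
  qed
  also have "(LINT z|lborel. of_real (e\<^sup>2 * inverse ((q z)\<^sup>2)) * g z) = (LINT z|lborel. bubble z * g (of_real e * z))"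
  proof -
    have [measurable]: "g \<in> borel_measurable borel" "q \<in> borel_measurable borel"
      by (intro borel_measurable_continuous_onI Ck_imp_continuous[OF g] Ck_imp_continuous[OF Ckq])+
    \<comment> \<open>The substitution by \<open>e * z\<close> has Jacobian \<open>e^2\<close>, and
      \<open>q (e * z) = e^2 * (1 + |z|^2)\<close>, so all powers of \<open>e\<close> cancel except
      inside \<open>g\<close>.\<close>
    have "(LINT z|lborel. of_real (e\<^sup>2 * inverse ((q z)\<^sup>2)) * g z) =
      (LINT z|lborel. of_real (e\<^sup>2) * (of_real (e\<^sup>2 * inverse ((q (of_real e * z))\<^sup>2)) * g (of_real e * z)))"
      by (rule integral_scale) (use e in auto)
    also have "\<dots> = (LINT z|lborel. bubble z * g (of_real e * z))"
    proof (rule Bochner_Integration.integral_cong)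
      fix z
      have "e\<^sup>2 * (e\<^sup>2 * inverse ((q (of_real e * z))\<^sup>2)) = inverse ((1 + (norm z)\<^sup>2)\<^sup>2)"
      proof -
        have "q (of_real e * z) = e\<^sup>2 * (1 + (norm z)\<^sup>2)"
          unfolding q by (simp add: norm_mult power_mult_distrib algebra_simps)
        moreover have "1 + (norm z)\<^sup>2 \<noteq> 0" using add_pos_nonneg[of 1 "(norm z)\<^sup>2"] by simp
        ultimately show ?thesis using e by (simp add: divide_simps power_mult_distrib)
      qed
      then show "of_real (e\<^sup>2) * (of_real (e\<^sup>2 * inverse ((q (of_real e * z))\<^sup>2)) * g (of_real e * z)) = bubble z * g (of_real e * z)"
        unfolding bubble_def by (metis mult.assoc of_real_mult)
    qed simp
    finally show ?thesis .
  qed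
  finally have "(LINT z|lborel. K z * wirt g z) + (LINT z|lborel. bubble z * g (of_real e * z)) = 0"
    unfolding distrib_left[symmetric] eq_commute[of 0] by (simp only: mult_eq_0_iff zero_neq_numeral[symmetric] simp_thms)
  then show ?thesis
    unfolding K_def q by (simp add: scaleR_conv_of_real add_eq_0_iff2)
qed

text \<open>The limit of \<open>regularized_cauchy\<close> as \<open>e\<close> tends to 0, by
  dominated convergence on both sides. The majorants are multiples of \<open>bubble\<close> and of
  the truncated \<open>1/|z|\<close>; the latter suffices because \<open>g\<close> vanishes outside
  the disc of radius 2.\<close>

lemma cauchy_pompeiu:
  fixes g :: "complex \<Rightarrow> complex"
  assumes g: "Ck (Suc 0) g" and supp: "\<And>z. norm z > 2 \<Longrightarrow> g z = 0"
  shows "(LINT z|lborel. inverse z * wirt g z) = - (LINT z|lborel. bubble z) * g 0"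
proof -
  have cg: "continuous_on UNIV g" by (rule Ck_imp_continuous[OF g])
  have cw: "continuous_on UNIV (wirt g)" unfolding wirt_def[abs_def]
    using Ck_SucD(2)[OF g] by (auto intro!: continuous_intros)
  have [measurable]: "g \<in> borel_measurable borel" "wirt g \<in> borel_measurable borel"
    by (intro borel_measurable_continuous_onI cg cw)+
  have [measurable]: "cnj \<in> borel_measurable borel"
    by (intro borel_measurable_continuous_onI continuous_intros)
  have supp': "wirt g z = 0" if "norm z > 2" for z
    using that by (simp add: wirt_def frechet_derivative_eq_0_outside[of 2 g, OF supp])
  have bounded: "\<exists>M\<ge>0. \<forall>z. norm (f z) \<le> M" if "continuous_on UNIV f" "\<And>z. norm z > 2 \<Longrightarrow> f z = 0" for f :: "complex \<Rightarrow> complex"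
  proof -
    have "compact (f ` cball 0 2)" using that(1) by (intro compact_continuous_image continuous_on_subset[OF that(1)]) auto
    then obtain M where "\<forall>x\<in>f ` cball 0 2. norm x \<le> M"
      using compact_imp_bounded bounded_iff by blast
    then have M: "\<And>z. norm z \<le> 2 \<Longrightarrow> norm (f z) \<le> M" by simp
    have "norm (f z) \<le> \<bar>M\<bar>" for z
      using M[of z] that(2)[of z] by (cases "norm z \<le> 2") auto
    then show ?thesis by (intro exI[of _ "\<bar>M\<bar>"]) auto
  qed
  obtain M1 where M1: "M1 \<ge> 0" "\<And>z. norm (g z) \<le> M1" using bounded[OF cg supp] by blast
  obtain M2 where M2: "M2 \<ge> 0" "\<And>z. norm (wirt g z) \<le> M2" using bounded[OF cw supp'] by blast
  define e where "e n = inverse (real (Suc n))" for n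
  have e: "e n > 0" for n by (simp add: e_def)
  have e0: "e \<longlonglongrightarrow> 0" unfolding e_def by (rule LIMSEQ_inverse_real_of_nat)
  have lim1: "(\<lambda>n. LINT z|lborel. bubble z * g (of_real (e n) * z)) \<longlonglongrightarrow> (LINT z|lborel. bubble z * g 0)"
  proof (rule integral_dominated_convergence[where w = "\<lambda>z. M1 * norm (bubble z)"])
    show "integrable lborel (\<lambda>z. M1 * norm (bubble z))" using integrable_bubble by simp
    show "AE z in lborel. (\<lambda>n. bubble z * g (of_real (e n) * z)) \<longlonglongrightarrow> bubble z * g 0"
    proof (intro AE_I2 tendsto_mult tendsto_const)
      fix z :: complex
      have "(\<lambda>n. of_real (e n) * z) \<longlonglongrightarrow> of_real 0 * z" by (intro tendsto_intros e0)
      then have "(\<lambda>n. of_real (e n) * z) \<longlonglongrightarrow> 0" by simp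
      then show "(\<lambda>n. g (of_real (e n) * z)) \<longlonglongrightarrow> g 0"
        by (rule continuous_on_tendsto_compose[OF cg]) auto
    qed
    show "AE z in lborel. norm (bubble z * g (of_real (e n) * z)) \<le> M1 * norm (bubble z)" for n
      by (intro AE_I2) (simp add: norm_mult mult.commute[of M1] mult_left_mono M1)
  qed simp_all
  have lim2: "(\<lambda>n. LINT z|lborel. inverse (of_real ((norm z)\<^sup>2 + (e n)\<^sup>2)) * cnj z * wirt g z) \<longlonglongrightarrow> (LINT z|lborel. inverse z * wirt g z)"
  proof (rule integral_dominated_convergence[where w = "\<lambda>z. M2 * norm (indicator (cball 0 2) z * inverse z)"])
    show "integrable lborel (\<lambda>z. M2 * norm (indicator (cball 0 2) z * inverse (z::complex)))"
      by (intro integrable_mult_right integrable_norm integrable_inverse_cball)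
    show "AE z in lborel. (\<lambda>n. inverse (of_real ((norm z)\<^sup>2 + (e n)\<^sup>2)) * cnj z * wirt g z) \<longlonglongrightarrow> inverse z * wirt g z"
    proof (rule AE_I2)
      fix z :: complex
      show "(\<lambda>n. inverse (of_real ((norm z)\<^sup>2 + (e n)\<^sup>2)) * cnj z * wirt g z) \<longlonglongrightarrow> inverse z * wirt g z"
      \<comment> \<open>At the singularity both sides are 0: \<open>cnj 0 = 0\<close> on the left,
        the convention \<open>inverse 0 = 0\<close> on the right.\<close>
      proof (cases "z = 0")
        case False
        have "(\<lambda>n. inverse (complex_of_real ((norm z)\<^sup>2 + (e n)\<^sup>2)) * cnj z * wirt g z) \<longlonglongrightarrow> inverse (of_real ((norm z)\<^sup>2 + 0\<^sup>2)) * cnj z * wirt g z"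
          by (intro tendsto_intros e0) (use False in auto)
        also have "inverse (complex_of_real ((norm z)\<^sup>2 + 0\<^sup>2)) * cnj z = inverse z"
        proof -
          have "complex_of_real ((norm z)\<^sup>2 + 0\<^sup>2) = z * cnj z"
            by (simp add: complex_norm_square del: of_real_power)
          then show ?thesis using False by (simp add: field_simps)
        qed
        finally show ?thesis .
      qed simp
    qed
    fix n
    show "AE z in lborel. norm (inverse (of_real ((norm z)\<^sup>2 + (e n)\<^sup>2)) * cnj z * wirt g z) \<le> M2 * norm (indicator (cball 0 2) z * inverse z)"
    proof (rule AE_I2)
      fix z :: complex
      show "norm (inverse (of_real ((norm z)\<^sup>2 + (e n)\<^sup>2)) * cnj z * wirt g z) \<le> M2 * norm (indicator (cball 0 2) z * inverse z)"
      proof (cases "z = 0 \<or> norm z > 2")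
        case True then show ?thesis using supp' M2(1) by auto
      next
        case False
        have "inverse ((norm z)\<^sup>2 + (e n)\<^sup>2) \<le> inverse ((norm z)\<^sup>2)"
          by (rule le_imp_inverse_le) (use False in auto)
        then have "inverse ((norm z)\<^sup>2 + (e n)\<^sup>2) * norm z \<le> inverse ((norm z)\<^sup>2) * norm z"
          by (rule mult_right_mono) simp
        also have "\<dots> = inverse (norm z)" using False by (simp add: power2_eq_square)
        finally have "inverse ((norm z)\<^sup>2 + (e n)\<^sup>2) * norm z * norm (wirt g z) \<le> inverse (norm z) * M2"
          by (intro mult_mono M2) auto
        moreover have "norm (inverse (complex_of_real ((norm z)\<^sup>2 + (e n)\<^sup>2)) * cnj z * wirt g z) = inverse ((norm z)\<^sup>2 + (e n)\<^sup>2) * norm z * norm (wirt g z)"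
          unfolding norm_mult norm_inverse norm_of_real by (simp add: abs_of_nonneg)
        moreover have "norm (indicator (cball 0 2) z * inverse z) = inverse (norm z)"
          using False by (simp add: norm_inverse)
        ultimately show ?thesis by (simp only: mult.commute[of M2])
      qed
    qed
  qed (simp, measurable)
  have "(\<lambda>n. LINT z|lborel. inverse (of_real ((norm z)\<^sup>2 + (e n)\<^sup>2)) * cnj z * wirt g z) \<longlonglongrightarrow> - (LINT z|lborel. bubble z * g 0)"
  proof -
    have "(LINT z|lborel. inverse (of_real ((norm z)\<^sup>2 + (e n)\<^sup>2)) * cnj z * wirt g z)
      = - (LINT z|lborel. bubble z * g (of_real (e n) * z))" for n
      by (rule regularized_cauchy[OF g supp e])
    then show ?thesis using tendsto_minus[OF lim1] by presburger
  qed
  from LIMSEQ_unique[OF lim2 this] show ?thesis by simp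
qed

subsection \<open>Convolution along a subspace\<close>

definition finite_norm :: "ennreal \<Rightarrow> ('a::euclidean_space \<Rightarrow> complex) \<Rightarrow> bool" where
  "finite_norm r f \<longleftrightarrow>
     (if r = \<infinity> then \<exists>M. AE x in lborel. norm (f x) \<le> M
      else (\<integral>\<^sup>+ x. ennreal (norm (f x) powr enn2real r) \<partial>lborel) < \<infinity>)"

lemma finite_norm_mono:
  assumes "finite_norm r g" "\<And>x. norm (f x) \<le> c * norm (g x)" "c \<ge> 0"
    and [measurable]: "g \<in> borel_measurable borel"
  shows "finite_norm r f"
proof (cases "r = \<infinity>")
  case True
  then obtain M where "AE x in lborel. norm (g x) \<le> M" using assms(1) by (auto simp: finite_norm_def)
  then have "AE x in lborel. norm (f x) \<le> c * M"
    by eventually_elim (use assms(2,3) in \<open>auto intro: order_trans mult_left_mono\<close>)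
  then show ?thesis using True by (auto simp: finite_norm_def)
next
  case False
  have "(\<integral>\<^sup>+ x. ennreal (norm (f x) powr enn2real r) \<partial>lborel)
    \<le> (\<integral>\<^sup>+ x. ennreal (c powr enn2real r) * ennreal (norm (g x) powr enn2real r) \<partial>lborel)"
  proof (rule nn_integral_mono)
    fix x
    have "norm (f x) powr enn2real r \<le> (c * norm (g x)) powr enn2real r"
      by (intro powr_mono2 assms) auto
    also have "\<dots> = c powr enn2real r * norm (g x) powr enn2real r"
      using assms(3) by (simp add: powr_mult)
    finally show "ennreal (norm (f x) powr enn2real r) \<le> ennreal (c powr enn2real r) * ennreal (norm (g x) powr enn2real r)"
      by (simp add: ennreal_leI flip: ennreal_mult)
  qed
  also have "\<dots> = ennreal (c powr enn2real r) * (\<integral>\<^sup>+ x. ennreal (norm (g x) powr enn2real r) \<partial>lborel)"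
    by (rule nn_integral_cmult) measurable
  also have "\<dots> < \<infinity>" using assms(1) False by (simp add: finite_norm_def ennreal_mult_less_top)
  finally show ?thesis using False by (simp add: finite_norm_def)
qed

text \<open>As only finiteness matters, the crude bound \<open>a + b \<le> 2 * max a b\<close>
  replaces Minkowski's inequality.\<close>

lemma finite_norm_add:
  assumes "finite_norm r f" "finite_norm r g"
    and [measurable]: "f \<in> borel_measurable borel" "g \<in> borel_measurable borel"
  shows "finite_norm r (\<lambda>x. f x + g x)"
proof (cases "r = \<infinity>")
  case True
  then obtain M N where "AE x in lborel. norm (f x) \<le> M" "AE x in lborel. norm (g x) \<le> N"
    using assms(1,2) by (auto simp: finite_norm_def)
  then have "AE x in lborel. norm (f x + g x) \<le> M + N"
    by eventually_elim (auto intro: order_trans[OF norm_triangle_ineq])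
  then show ?thesis using True by (auto simp: finite_norm_def)
next
  case False
  let ?p = "enn2real r"
  have "(\<integral>\<^sup>+ x. ennreal (norm (f x + g x) powr ?p) \<partial>lborel)
    \<le> (\<integral>\<^sup>+ x. ennreal (2 powr ?p) * (ennreal (norm (f x) powr ?p) + ennreal (norm (g x) powr ?p)) \<partial>lborel)"
  proof (rule nn_integral_mono)
    fix x
    define a b where "a = norm (f x)" and "b = norm (g x)"
    have "norm (f x + g x) powr ?p \<le> (2 * max a b) powr ?p"
      using norm_triangle_ineq[of "f x" "g x"] by (intro powr_mono2) (auto simp: a_def b_def)
    also have "\<dots> = 2 powr ?p * max a b powr ?p" by (rule powr_mult)
    also have "\<dots> \<le> 2 powr ?p * (a powr ?p + b powr ?p)"
      by (intro mult_left_mono) (auto simp: max_def)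
    finally show "ennreal (norm (f x + g x) powr ?p) \<le> ennreal (2 powr ?p) * (ennreal (norm (f x) powr ?p) + ennreal (norm (g x) powr ?p))"
      by (simp add: a_def b_def ennreal_leI flip: ennreal_mult ennreal_plus)
  qed
  also have "\<dots> = ennreal (2 powr ?p) * ((\<integral>\<^sup>+ x. ennreal (norm (f x) powr ?p) \<partial>lborel) + (\<integral>\<^sup>+ x. ennreal (norm (g x) powr ?p) \<partial>lborel))"
    by (simp add: nn_integral_cmult nn_integral_add)
  also have "\<dots> < \<infinity>" using assms(1,2) False by (simp add: finite_norm_def ennreal_mult_less_top)
  finally show ?thesis using False by (simp add: finite_norm_def)
qed

section \<open>A qualitative form of Young's inequality\<close>

text \<open>Above the threshold \<open>s\<close> one has
  \<open>t = t powr (1 - p) * t powr p\<close>, and the first factor decreases in \<open>t\<close>.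
  Keeping \<open>s\<close> free lets this linear bound do the work of Hoelder's inequality once it
  has been integrated.\<close>

lemma le_add_powr:
  fixes t s p :: real
  assumes "t \<ge> 0" "s > 0" "p \<ge> 1"
  shows "t \<le> s + s powr (1 - p) * t powr p"
proof (cases "t \<le> s")
  case True
  then show ?thesis by (simp add: add_increasing2)
next
  case False
  have "t = t powr (1 - p) * t powr p" using False assms by (simp flip: powr_add)
  also have "\<dots> \<le> s powr (1 - p) * t powr p"
    using False assms by (intro mult_right_mono powr_mono2') auto
  finally show ?thesis using assms by linarith
qed

lemma powr_le_of_forall_scale:
  fixes a W I p :: real
  assumes W: "W > 0" and a: "a \<ge> 0" and I: "I \<ge> 0" and p: "p \<ge> 1"
    and le: "\<And>s. s > 0 \<Longrightarrow> a \<le> s * W + s powr (1 - p) * I"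
  shows "a powr p \<le> (2 * W) powr p / W * I"
proof (cases "a = 0")
  case True
  then show ?thesis using assms by simp
next
  case False
  \<comment> \<open>With this choice \<open>s * W\<close> is half of \<open>a\<close> and is
    absorbed on the left.\<close>
  define s where "s = a / (2 * W)"
  have s: "s > 0" using False a W by (simp add: s_def)
  have aW: "a = s * (2 * W)" using W by (simp add: s_def)
  have "s * W \<le> s powr (1 - p) * I" using le[OF s] aW by (simp add: mult.commute)
  then have "s powr p * (s * W) \<le> s powr p * (s powr (1 - p) * I)"
    by (intro mult_left_mono) auto
  also have "\<dots> = s * I" using s by (simp add: mult.assoc[symmetric] flip: powr_add)
  finally have "s powr p * W \<le> I" using s by (simp add: mult.left_commute)
  then have "s powr p \<le> I / W" using W by (simp add: field_simps)
  then have "s powr p * (2 * W) powr p \<le> I / W * (2 * W) powr p" by (rule mult_right_mono) simp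
  then show ?thesis using s W by (simp add: aW powr_mult mult.commute)
qed

lemma nn_integral_translate:
  fixes f :: "'a::euclidean_space \<Rightarrow> ennreal"
  assumes [measurable]: "f \<in> borel_measurable borel"
  shows "(\<integral>\<^sup>+ x. f (x - c) \<partial>lborel) = (\<integral>\<^sup>+ x. f x \<partial>lborel)"
proof -
  have "(\<integral>\<^sup>+ x. f x \<partial>distr lborel borel ((+) (- c))) = (\<integral>\<^sup>+ x. f (- c + x) \<partial>lborel)"
    by (rule nn_integral_distr) auto
  then show ?thesis by (simp add: lborel_distr_plus)
qed

lemma AE_translate:
  fixes P :: "'a::euclidean_space \<Rightarrow> bool"
  assumes [measurable]: "Measurable.pred borel P" and "AE x in lborel. P x"
  shows "AE x in lborel. P (x - c)"
proof -
  have "AE x in distr lborel borel ((+) (- c)). P x" unfolding lborel_distr_plus by (rule assms(2))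
  then have "AE x in lborel. P (- c + x)" by (subst (asm) AE_distr_iff) auto
  then show ?thesis by simp
qed

context smearing
begin

definition convolve :: "('a \<Rightarrow> complex) \<Rightarrow> 'a \<Rightarrow> complex" where
  "convolve f z = (LINT y|lborel. h y * f (z - L y))"

lemma measurable_shift [measurable]:
  assumes [measurable]: "f \<in> borel_measurable borel"
  shows "(\<lambda>(z, y). f (z - L y)) \<in> borel_measurable (borel \<Otimes>\<^sub>M borel)"
    "(\<lambda>(z, y). f (z + L y)) \<in> borel_measurable (borel \<Otimes>\<^sub>M borel)"
  by measurable

lemma measurable_convolve:
  assumes [measurable]: "f \<in> borel_measurable borel"
  shows "convolve f \<in> borel_measurable borel"
proof -
  have "(\<lambda>z. LINT y|lborel. h y * f (z - L y)) \<in> borel_measurable lborel"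
    by (rule lborel.borel_measurable_lebesgue_integral) measurable
  then show ?thesis by (simp add: convolve_def[abs_def])
qed

text \<open>Integrability is not assumed: at a point where the integrand is not integrable,
  \<open>convolve\<close> has the default value 0.\<close>

lemma norm_convolve_le:
  "ennreal (norm (convolve f z)) \<le> (\<integral>\<^sup>+ y. ennreal (norm (h y) * norm (f (z - L y))) \<partial>lborel)"
proof (cases "Bochner_Integration.integrable lborel (\<lambda>y. h y * f (z - L y))")
  case True
  show ?thesis unfolding convolve_def
    using integral_norm_bound_ennreal[OF True] by (simp add: norm_mult)
next
  case False
  then show ?thesis by (simp add: convolve_def not_integrable_integral_eq)
qed

text \<open>The summand 1 makes the constant positive for every kernel, so that it may be divided
  by.\<close>

definition mass :: real where "mass = (LINT y|lborel. norm (h y)) + 1"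

lemma mass_pos: "mass > 0"
  unfolding mass_def by (simp add: add_nonneg_pos)

lemma nn_integral_h: "(\<integral>\<^sup>+ y. ennreal (norm (h y)) \<partial>lborel) \<le> ennreal mass"
  using nn_integral_eq_integral[OF integrable_norm[OF integrable]]
  by (simp add: mass_def ennreal_leI)

text \<open>Jensen's inequality up to a constant: integrate \<open>le_add_powr\<close> against
  \<open>norm (h y)\<close>, then optimize the threshold by
  \<open>powr_le_of_forall_scale\<close>.\<close>

lemma powr_convolve_le:
  assumes [measurable]: "f \<in> borel_measurable borel" and p: "p \<ge> 1"
  shows "ennreal (norm (convolve f z) powr p)
    \<le> ennreal ((2 * mass) powr p / mass) * (\<integral>\<^sup>+ y. ennreal (norm (h y)) * ennreal (norm (f (z - L y)) powr p) \<partial>lborel)"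
    (is "_ \<le> _ * ?I")
proof (cases "?I = \<infinity>")
  case True
  then show ?thesis using mass_pos by (simp add: ennreal_mult_top)
next
  case False
  have meas [measurable]: "(\<lambda>y. f (z - L y)) \<in> borel_measurable borel" by measurable
  define I where "I = enn2real ?I"
  have I: "?I = ennreal I" using False by (simp add: I_def less_top)
  have "norm (convolve f z) \<le> s * mass + s powr (1 - p) * I" if s: "s > 0" for s
  proof -
    have "ennreal (norm (convolve f z)) \<le> (\<integral>\<^sup>+ y. ennreal (norm (h y) * norm (f (z - L y))) \<partial>lborel)"
      by (rule norm_convolve_le)
    also have "\<dots> \<le> (\<integral>\<^sup>+ y. ennreal s * ennreal (norm (h y)) + ennreal (s powr (1 - p)) * (ennreal (norm (h y)) * ennreal (norm (f (z - L y)) powr p)) \<partial>lborel)"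
    proof (rule nn_integral_mono)
      fix y
      have "norm (h y) * norm (f (z - L y)) \<le> norm (h y) * (s + s powr (1 - p) * norm (f (z - L y)) powr p)"
        by (intro mult_left_mono le_add_powr s p) auto
      also have "\<dots> = s * norm (h y) + s powr (1 - p) * (norm (h y) * norm (f (z - L y)) powr p)"
        by (simp add: algebra_simps)
      finally show "ennreal (norm (h y) * norm (f (z - L y))) \<le> ennreal s * ennreal (norm (h y)) + ennreal (s powr (1 - p)) * (ennreal (norm (h y)) * ennreal (norm (f (z - L y)) powr p))"
        using s by (simp add: ennreal_leI flip: ennreal_mult ennreal_plus)
    qed
    also have "\<dots> = ennreal s * (\<integral>\<^sup>+ y. ennreal (norm (h y)) \<partial>lborel) + ennreal (s powr (1 - p)) * ?I"
      by (simp add: nn_integral_add nn_integral_cmult)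
    also have "\<dots> \<le> ennreal s * ennreal mass + ennreal (s powr (1 - p)) * ennreal I"
      unfolding I by (intro add_right_mono mult_left_mono nn_integral_h) simp
    also have "\<dots> = ennreal (s * mass + s powr (1 - p) * I)"
      using s mass_pos by (simp add: I_def flip: ennreal_mult ennreal_plus)
    finally show ?thesis
      using s mass_pos by (subst (asm) ennreal_le_iff) (auto simp: I_def)
  qed
  from powr_le_of_forall_scale[OF mass_pos _ _ p this]
  have "norm (convolve f z) powr p \<le> (2 * mass) powr p / mass * I" by (simp add: I_def)
  then show ?thesis unfolding I using mass_pos
    by (simp add: ennreal_leI I_def flip: ennreal_mult)
qed

text \<open>For each \<open>y\<close> the translation by \<open>L y\<close> preserves Lebesgue
  measure on the whole space, so only the integral of \<open>norm (h y)\<close> enters. For finite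
  \<open>r\<close> the pointwise bound is integrated in \<open>z\<close> and the order of
  integration exchanged.\<close>

lemma finite_norm_convolve:
  assumes f: "finite_norm r f" and r: "r \<ge> 1" and [measurable]: "f \<in> borel_measurable borel"
  shows "finite_norm r (convolve f)"
proof (cases "r = \<infinity>")
  case True
  then obtain M where M: "AE x in lborel. norm (f x) \<le> M" using f by (auto simp: finite_norm_def)
  have "AE z in lborel. norm (f (z - L y)) \<le> M" for y
    by (rule AE_translate[of "\<lambda>x. norm (f x) \<le> M", OF _ M]) measurable
  \<comment> \<open>The exceptional null set depends on \<open>y\<close>. Fubini exchanges the
    quantifiers, so that for almost every \<open>z\<close> the bound holds for almost all
    \<open>y\<close>.\<close>
  then have "AE y in lborel. AE z in lborel. norm (f (z - L y)) \<le> M" by (rule AE_I2)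
  then have "AE z in lborel. AE y in lborel. norm (f (z - L y)) \<le> M"
    by (subst lborel_pair.AE_commute) measurable
  then have "AE z in lborel. norm (convolve f z) \<le> \<bar>M\<bar> * mass"
  proof eventually_elim
    case (elim z)
    have "ennreal (norm (convolve f z)) \<le> (\<integral>\<^sup>+ y. ennreal (norm (h y) * norm (f (z - L y))) \<partial>lborel)"
      by (rule norm_convolve_le)
    also have "\<dots> \<le> (\<integral>\<^sup>+ y. ennreal \<bar>M\<bar> * ennreal (norm (h y)) \<partial>lborel)"
    proof (rule nn_integral_mono_AE, use elim in eventually_elim)
      case (elim y)
      have "norm (h y) * norm (f (z - L y)) \<le> norm (h y) * \<bar>M\<bar>"
        using elim by (intro mult_left_mono) auto
      then show ?case by (simp add: ennreal_leI mult.commute flip: ennreal_mult)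
    qed
    also have "\<dots> = ennreal \<bar>M\<bar> * (\<integral>\<^sup>+ y. ennreal (norm (h y)) \<partial>lborel)"
      by (rule nn_integral_cmult) measurable
    also have "\<dots> \<le> ennreal \<bar>M\<bar> * ennreal mass" by (intro mult_left_mono nn_integral_h) simp
    also have "\<dots> = ennreal (\<bar>M\<bar> * mass)" using mass_pos by (simp add: ennreal_mult)
    finally show ?case using mass_pos by (subst (asm) ennreal_le_iff) auto
  qed
  then show ?thesis using True by (auto simp: finite_norm_def)
next
  case False
  define p where "p = enn2real r"
  have p: "p \<ge> 1" using enn2real_mono[of 1 r] False r by (simp add: p_def less_top)
  have [measurable]: "(\<lambda>x. ennreal (norm (f x) powr p)) \<in> borel_measurable borel" by measurable
  have "(\<integral>\<^sup>+ z. ennreal (norm (convolve f z) powr p) \<partial>lborel)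
    \<le> (\<integral>\<^sup>+ z. ennreal ((2 * mass) powr p / mass) * (\<integral>\<^sup>+ y. ennreal (norm (h y)) * ennreal (norm (f (z - L y)) powr p) \<partial>lborel) \<partial>lborel)"
    by (intro nn_integral_mono powr_convolve_le p) measurable
  also have "\<dots> = ennreal ((2 * mass) powr p / mass) * (\<integral>\<^sup>+ z. (\<integral>\<^sup>+ y. ennreal (norm (h y)) * ennreal (norm (f (z - L y)) powr p) \<partial>lborel) \<partial>lborel)"
    by (rule nn_integral_cmult) measurable
  also have "(\<integral>\<^sup>+ z. (\<integral>\<^sup>+ y. ennreal (norm (h y)) * ennreal (norm (f (z - L y)) powr p) \<partial>lborel) \<partial>lborel)
    = (\<integral>\<^sup>+ y. (\<integral>\<^sup>+ z. ennreal (norm (h y)) * ennreal (norm (f (z - L y)) powr p) \<partial>lborel) \<partial>lborel)"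
    by (rule lborel_pair.Fubini'[symmetric]) measurable
  also have "\<dots> = (\<integral>\<^sup>+ y. ennreal (norm (h y)) * (\<integral>\<^sup>+ z. ennreal (norm (f z) powr p) \<partial>lborel) \<partial>lborel)"
  proof (rule nn_integral_cong)
    fix y
    have "(\<integral>\<^sup>+ z. ennreal (norm (h y)) * ennreal (norm (f (z - L y)) powr p) \<partial>lborel)
      = ennreal (norm (h y)) * (\<integral>\<^sup>+ z. ennreal (norm (f (z - L y)) powr p) \<partial>lborel)"
      by (rule nn_integral_cmult) measurable
    also have "(\<integral>\<^sup>+ z. ennreal (norm (f (z - L y)) powr p) \<partial>lborel) = (\<integral>\<^sup>+ z. ennreal (norm (f z) powr p) \<partial>lborel)"
      by (rule nn_integral_translate[of "\<lambda>x. ennreal (norm (f x) powr p)"]) measurable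
    finally show "(\<integral>\<^sup>+ z. ennreal (norm (h y)) * ennreal (norm (f (z - L y)) powr p) \<partial>lborel)
      = ennreal (norm (h y)) * (\<integral>\<^sup>+ z. ennreal (norm (f z) powr p) \<partial>lborel)" .
  qed
  also have "\<dots> = (\<integral>\<^sup>+ y. ennreal (norm (h y)) \<partial>lborel) * (\<integral>\<^sup>+ z. ennreal (norm (f z) powr p) \<partial>lborel)"
    by (rule nn_integral_multc) measurable
  also have "ennreal ((2 * mass) powr p / mass) * \<dots> < \<infinity>"
    using f False order_le_less_trans[OF nn_integral_h ennreal_less_top]
    by (simp add: finite_norm_def p_def ennreal_mult_less_top)
  finally show ?thesis using False by (simp add: finite_norm_def p_def)
qed

text \<open>Transposition by Fubini and the translation \<open>z = w + L y\<close> for fixed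
  \<open>y\<close>.\<close>

lemma integral_convolve_mult:
  assumes f: "Bochner_Integration.integrable lborel f"
    and [measurable]: "\<psi> \<in> borel_measurable borel" and M: "\<And>x. norm (\<psi> x) \<le> M"
  shows "(LINT z|lborel. convolve f z * \<psi> z) = (LINT w|lborel. f w * smear h L \<psi> w)"
proof -
  have [measurable]: "f \<in> borel_measurable borel" using borel_measurable_integrable[OF f] by simp
  have M0: "M \<ge> 0" using M[of 0] norm_ge_zero order_trans by blast
  have fin: "(\<integral>\<^sup>+ w. ennreal (norm (f w)) \<partial>lborel) < \<infinity>"
    using f by (simp add: integrable_iff_bounded)
  have hfin: "(\<integral>\<^sup>+ y. ennreal (norm (h y)) \<partial>lborel) < \<infinity>"
    using integrable by (simp add: integrable_iff_bounded)
  \<comment> \<open>Covers the double integrals before and after the translation: for each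
    \<open>y\<close>, \<open>u\<close> is a translate of \<open>f\<close> or \<open>f\<close>
    itself, and \<open>v\<close> is bounded by \<open>M\<close>.\<close>
  have int: "Bochner_Integration.integrable (lborel \<Otimes>\<^sub>M lborel) (\<lambda>(z, y). h y * u z y * v z y)"
    if [measurable]: "(\<lambda>(z, y). u z y) \<in> borel_measurable (borel \<Otimes>\<^sub>M borel)" "(\<lambda>(z, y). v z y) \<in> borel_measurable (borel \<Otimes>\<^sub>M borel)"
      and u: "\<And>y. (\<integral>\<^sup>+ z. ennreal (norm (u z y)) \<partial>lborel) = (\<integral>\<^sup>+ w. ennreal (norm (f w)) \<partial>lborel)"
      and v: "\<And>z y. norm (v z y) \<le> M"
    for u v :: "'a \<Rightarrow> 'b \<Rightarrow> complex"
  proof (rule integrableI_bounded)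
    show "(\<lambda>(z, y). h y * u z y * v z y) \<in> borel_measurable (lborel \<Otimes>\<^sub>M lborel)" by measurable
    have "(\<integral>\<^sup>+ x. ennreal (norm (case x of (z, y) \<Rightarrow> h y * u z y * v z y)) \<partial>(lborel \<Otimes>\<^sub>M lborel))
      = (\<integral>\<^sup>+ y. \<integral>\<^sup>+ z. ennreal (norm (h y * u z y * v z y)) \<partial>lborel \<partial>lborel)"
      by (subst lborel_pair.nn_integral_snd[symmetric]) measurable
    also have "\<dots> \<le> (\<integral>\<^sup>+ y. \<integral>\<^sup>+ z. ennreal (M * norm (h y)) * ennreal (norm (u z y)) \<partial>lborel \<partial>lborel)"
    proof (intro nn_integral_mono)
      fix y z
      have "norm (h y) * norm (u z y) * norm (v z y) \<le> norm (h y) * norm (u z y) * M"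
        by (intro mult_left_mono v) auto
      then show "ennreal (norm (h y * u z y * v z y)) \<le> ennreal (M * norm (h y)) * ennreal (norm (u z y))"
        using M0 by (simp add: norm_mult ennreal_leI mult_ac flip: ennreal_mult)
    qed
    also have "\<dots> = (\<integral>\<^sup>+ y. ennreal (M * norm (h y)) * (\<integral>\<^sup>+ w. ennreal (norm (f w)) \<partial>lborel) \<partial>lborel)"
    proof (rule nn_integral_cong)
      fix y
      have "(\<integral>\<^sup>+ z. ennreal (M * norm (h y)) * ennreal (norm (u z y)) \<partial>lborel)
         = ennreal (M * norm (h y)) * (\<integral>\<^sup>+ z. ennreal (norm (u z y)) \<partial>lborel)"
        by (rule nn_integral_cmult) measurable
      then show "(\<integral>\<^sup>+ z. ennreal (M * norm (h y)) * ennreal (norm (u z y)) \<partial>lborel) = ennreal (M * norm (h y)) * (\<integral>\<^sup>+ w. ennreal (norm (f w)) \<partial>lborel)"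
        by (simp add: u)
    qed
    also have "\<dots> = (\<integral>\<^sup>+ y. ennreal M * ennreal (norm (h y)) \<partial>lborel) * (\<integral>\<^sup>+ w. ennreal (norm (f w)) \<partial>lborel)"
      using M0 by (simp add: nn_integral_multc ennreal_mult)
    also have "\<dots> = ennreal M * (\<integral>\<^sup>+ y. ennreal (norm (h y)) \<partial>lborel) * (\<integral>\<^sup>+ w. ennreal (norm (f w)) \<partial>lborel)"
      by (simp add: nn_integral_cmult)
    also have "\<dots> < \<infinity>" using fin hfin by (simp add: ennreal_mult_less_top)
    finally show "(\<integral>\<^sup>+ x. ennreal (norm (case x of (z, y) \<Rightarrow> h y * u z y * v z y)) \<partial>(lborel \<Otimes>\<^sub>M lborel)) < \<infinity>" .
  qed
  have [measurable]: "(\<lambda>x. ennreal (norm (f x))) \<in> borel_measurable borel" by measurable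
  have i1: "Bochner_Integration.integrable (lborel \<Otimes>\<^sub>M lborel) (\<lambda>(z, y). h y * f (z - L y) * \<psi> z)"
    by (intro int M nn_integral_translate[of "\<lambda>x. ennreal (norm (f x))"]) measurable
  have i2: "Bochner_Integration.integrable (lborel \<Otimes>\<^sub>M lborel) (\<lambda>(w, y). h y * f w * \<psi> (w + L y))"
    by (intro int M refl) measurable
  have "(LINT z|lborel. convolve f z * \<psi> z) = (LINT z|lborel. LINT y|lborel. h y * f (z - L y) * \<psi> z)"
    by (simp add: convolve_def)
  also have "\<dots> = (LINT y|lborel. LINT z|lborel. h y * f (z - L y) * \<psi> z)"
    by (rule lborel_pair.Fubini_integral[OF i1, symmetric])
  also have "\<dots> = (LINT y|lborel. LINT w|lborel. h y * f w * \<psi> (w + L y))"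
  proof (rule Bochner_Integration.integral_cong)
    fix y
    have "(LINT z|lborel. h y * f (L y + z - L y) * \<psi> (L y + z)) = (LINT z|lborel. h y * f (z - L y) * \<psi> z)"
      by (rule integral_translate[of "\<lambda>z. h y * f (z - L y) * \<psi> z" "L y"]) measurable
    then show "(LINT z|lborel. h y * f (z - L y) * \<psi> z) = (LINT w|lborel. h y * f w * \<psi> (w + L y))"
      by (simp add: add.commute)
  qed simp
  also have "\<dots> = (LINT w|lborel. LINT y|lborel. h y * f w * \<psi> (w + L y))"
    by (rule lborel_pair.Fubini_integral[OF i2])
  also have "\<dots> = (LINT w|lborel. f w * smear h L \<psi> w)"
  proof (rule Bochner_Integration.integral_cong)
    fix w
    have "(LINT y|lborel. h y * f w * \<psi> (w + L y)) = (LINT y|lborel. f w * (h y * \<psi> (w + L y)))"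
      by (simp add: mult_ac)
    then show "(LINT y|lborel. h y * f w * \<psi> (w + L y)) = f w * smear h L \<psi> w"
      by (simp add: smear_def)
  qed simp
  finally show ?thesis .
qed

end

subsection \<open>Test functions\<close>

lemma test_function_iff: "test_function \<phi> \<longleftrightarrow> (\<forall>k. Ck k \<phi>) \<and> (\<exists>B. \<forall>x. \<phi> x \<noteq> 0 \<longrightarrow> norm x \<le> B)"
  by (simp add: test_function_def compact_closure bounded_iff)

lemma test_function_continuous: "test_function \<phi> \<Longrightarrow> continuous_on UNIV \<phi>"
  by (auto simp: test_function_iff intro: Ck_imp_continuous)

lemma test_function_measurable: "test_function \<phi> \<Longrightarrow> \<phi> \<in> borel_measurable borel"
  by (intro borel_measurable_continuous_onI test_function_continuous)

lemma test_function_bounded: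
  assumes "test_function \<phi>"
  obtains M where "\<And>x. norm (\<phi> x) \<le> M"
proof -
  obtain B where B: "\<And>x. \<phi> x \<noteq> 0 \<Longrightarrow> norm x \<le> B" using assms by (auto simp: test_function_iff)
  have "compact (\<phi> ` cball 0 B)"
    by (intro compact_continuous_image continuous_on_subset[OF test_function_continuous[OF assms]]) auto
  then obtain M where M: "\<forall>x\<in>\<phi> ` cball 0 B. norm x \<le> M"
    using compact_imp_bounded bounded_iff by blast
  have "norm (\<phi> x) \<le> \<bar>M\<bar>" for x
  proof (cases "\<phi> x = 0")
    case False
    then have "norm (\<phi> x) \<le> M" using M B[OF False] by auto
    then show ?thesis by simp
  qed simp
  then show ?thesis by (rule that)
qed

lemma test_function_wirtinger_bar:
  assumes "test_function \<phi>"
  shows "test_function (wirtinger_bar j \<phi>)"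
proof -
  have Ck: "Ck k \<phi>" for k using assms by (simp add: test_function_iff)
  obtain B where B: "\<And>x. \<phi> x \<noteq> 0 \<Longrightarrow> norm x \<le> B" using assms by (auto simp: test_function_iff)
  have "Ck k (\<lambda>z. (1/2) * (frechet_derivative \<phi> (at z) (axis j 1) + \<i> * frechet_derivative \<phi> (at z) (axis j \<i>)))" for k
    by (intro Ck_mult Ck_add Ck_const Ck_SucD(2)[OF Ck])
  then have "Ck k (wirtinger_bar j \<phi>)" for k by (simp add: wirtinger_bar_def[abs_def])
  moreover have "norm x \<le> B" if "wirtinger_bar j \<phi> x \<noteq> 0" for x
  proof (rule ccontr)
    assume "\<not> norm x \<le> B"
    then have "frechet_derivative \<phi> (at x) = (\<lambda>v. 0)"
      by (intro frechet_derivative_eq_0_outside[of B]) (use B in force)+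
    then show False using that by (simp add: wirtinger_bar_def)
  qed
  ultimately show ?thesis unfolding test_function_iff by blast
qed

definition cut :: "(complex \<Rightarrow> complex) \<Rightarrow> 'n \<Rightarrow> (complex ^ 'n \<Rightarrow> complex) \<Rightarrow> complex ^ 'n::finite \<Rightarrow> complex" where
  "cut m k \<phi> z = m (z $ k) * \<phi> z"

lemma Ck_nth:
  assumes "Ck k m" shows "Ck k (\<lambda>z :: complex ^ 'n::finite. m (z $ i))"
  using Ck_compose_bounded_linear[OF bounded_linear_vec_nth assms, of 0] by simp

lemma test_function_cut:
  assumes "test_function \<phi>" "\<And>k. Ck k m"
  shows "test_function (cut m i \<phi>)"
  unfolding test_function_iff
proof
  show "\<forall>k. Ck k (cut m i \<phi>)"
    using assms by (auto simp: cut_def[abs_def] test_function_iff intro!: Ck_mult Ck_nth)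
  show "\<exists>B. \<forall>x. cut m i \<phi> x \<noteq> 0 \<longrightarrow> norm x \<le> B"
    using assms(1) by (auto simp: cut_def test_function_iff)
qed

lemma frechet_derivative_cut:
  fixes z :: "complex ^ 'n::finite"
  assumes "Ck (Suc 0) m" "Ck (Suc 0) \<phi>"
  shows "frechet_derivative (cut m i \<phi>) (at z) v =
    m (z $ i) * frechet_derivative \<phi> (at z) v + frechet_derivative m (at (z $ i)) (v $ i) * \<phi> z"
proof -
  have "((\<lambda>z. m (z $ i)) has_derivative (\<lambda>v. frechet_derivative m (at (z $ i)) (v $ i))) (at z)"
    by (rule has_derivative_compose[OF bounded_linear_imp_has_derivative[OF bounded_linear_vec_nth] Ck_SucD(1)[OF assms(1)]])
  from has_derivative_mult[OF this Ck_SucD(1)[OF assms(2)]]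
  have "(cut m i \<phi> has_derivative (\<lambda>v. m (z $ i) * frechet_derivative \<phi> (at z) v + frechet_derivative m (at (z $ i)) (v $ i) * \<phi> z)) (at z)"
    by (simp add: cut_def[abs_def])
  from frechet_derivative_at[OF this, symmetric] show ?thesis by simp
qed

lemma frechet_derivative_zero_arg:
  "Ck (Suc 0) m \<Longrightarrow> frechet_derivative m (at z) 0 = 0"
  using linear_0[OF bounded_linear.linear[OF has_derivative_bounded_linear[OF Ck_SucD(1)]]] .

lemma wirtinger_bar_cut_neq:
  assumes "Ck (Suc 0) m" "Ck (Suc 0) \<phi>" "j \<noteq> i"
  shows "wirtinger_bar j (cut m i \<phi>) = cut m i (wirtinger_bar j \<phi>)"
  using assms
  by (intro ext) (simp add: wirtinger_bar_def cut_def[of _ _ "\<lambda>z. _ z"] cut_def[of _ _ "wirtinger_bar _ _"] frechet_derivative_cut axis_def frechet_derivative_zero_arg algebra_simps add_divide_distrib)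

lemma wirtinger_bar_cut_eq:
  assumes "Ck (Suc 0) m" "Ck (Suc 0) \<phi>"
  shows "wirtinger_bar i (cut m i \<phi>) = (\<lambda>z. cut m i (wirtinger_bar i \<phi>) z + cut (wirt m) i \<phi> z)"
  using assms
  by (intro ext) (simp add: wirtinger_bar_def wirt_def cut_def[of _ _ "wirtinger_bar _ _"] cut_def[of "wirt _"] frechet_derivative_cut algebra_simps add_divide_distrib)

lemma Ck_wirt: "(\<And>k. Ck k m) \<Longrightarrow> Ck k (wirt m)"
proof -
  assume m: "\<And>k. Ck k m"
  have "Ck k (\<lambda>z. (1/2) * (frechet_derivative m (at z) 1 + \<i> * frechet_derivative m (at z) \<i>))"
    by (intro Ck_mult Ck_add Ck_const Ck_SucD(2)[OF m])
  then show ?thesis by (simp add: wirt_def[abs_def])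
qed

lemma wirt_eq_0:
  assumes "open S" "z \<in> S" "\<And>x. x \<in> S \<Longrightarrow> m x = c"
  shows "wirt m z = 0"
proof -
  have "((\<lambda>_. c) has_derivative (\<lambda>_. 0)) (at z)" by simp
  then have "(m has_derivative (\<lambda>_. 0)) (at z)"
    by (rule has_derivative_transform_within_open[of _ _ _ _ S]) (use assms in auto)
  then have "frechet_derivative m (at z) = (\<lambda>_. 0)" by (rule frechet_derivative_at[symmetric])
  then show ?thesis by (simp add: wirt_def)
qed

section \<open>Smearing as a map of test functions\<close>

context smearing
begin

lemma smear_nonzero:
  assumes "smear h L \<psi> w \<noteq> 0"
  obtains y where "h y \<noteq> 0" "\<psi> (w + L y) \<noteq> 0"
proof -
  have "\<exists>y. h y * \<psi> (w + L y) \<noteq> 0"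
  proof (rule ccontr)
    assume "\<not> ?thesis"
    then have "smear h L \<psi> w = (LINT y|(lborel :: 'b measure). 0)" unfolding smear_def by (intro Bochner_Integration.integral_cong) auto
    then show False using assms by simp
  qed
  then show ?thesis using that by auto
qed

lemma convolve_nonzero:
  assumes "convolve \<psi> w \<noteq> 0"
  obtains y where "h y \<noteq> 0" "\<psi> (w - L y) \<noteq> 0"
proof -
  have "\<exists>y. h y * \<psi> (w - L y) \<noteq> 0"
  proof (rule ccontr)
    assume "\<not> ?thesis"
    then have "convolve \<psi> w = (LINT y|(lborel :: 'b measure). 0)" unfolding convolve_def by (intro Bochner_Integration.integral_cong) auto
    then show False using assms by simp
  qed
  then show ?thesis using that by auto
qed

lemma test_function_smear:
  assumes "test_function \<psi>"
  shows "test_function (smear h L \<psi>)"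
  unfolding test_function_iff
proof
  show "\<forall>k. Ck k (smear h L \<psi>)"
    using assms by (auto simp: test_function_iff intro!: Ck_smear)
  obtain C where C: "\<And>x. \<psi> x \<noteq> 0 \<Longrightarrow> norm x \<le> C" using assms by (auto simp: test_function_iff)
  obtain B where B: "\<And>y. h y \<noteq> 0 \<Longrightarrow> norm (L y) \<le> B" using bound_L by blast
  have "norm w \<le> C + B" if nz: "smear h L \<psi> w \<noteq> 0" for w
  proof -
    obtain y where "h y \<noteq> 0" "\<psi> (w + L y) \<noteq> 0" using nz by (rule smear_nonzero)
    then show ?thesis using C[of "w + L y"] B[of y] norm_triangle_ineq4[of "w + L y" "L y"] by simp
  qed
  then show "\<exists>B. \<forall>x. smear h L \<psi> x \<noteq> 0 \<longrightarrow> norm x \<le> B" by blast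
qed

lemma smear_add:
  assumes "continuous_on UNIV a" "continuous_on UNIV b"
  shows "smear h L (\<lambda>x. a x + b x) w = smear h L a w + smear h L b w"
  unfolding smear_def distrib_left
  by (intro Bochner_Integration.integral_add integrable_smear assms)

lemma smear_cmult: "smear h L (\<lambda>x. c * a x) w = c * smear h L a w"
  unfolding smear_def mult.left_commute[of _ c] by (rule integral_mult_right_zero)

end

lemma wirtinger_bar_smear:
  fixes L :: "'b::euclidean_space \<Rightarrow> complex ^ 'n::finite"
  assumes "smearing h L R" "Ck (Suc 0) \<psi>"
  shows "wirtinger_bar j (smear h L \<psi>) = smear h L (wirtinger_bar j \<psi>)"
proof
  fix w
  interpret smearing h L R by fact
  have c: "continuous_on UNIV (\<lambda>x. frechet_derivative \<psi> (at x) v)" for v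
    using Ck_SucD(2)[OF assms(2)] by simp
  have "smear h L (wirtinger_bar j \<psi>) w =
      smear h L (\<lambda>x. (1/2) * (frechet_derivative \<psi> (at x) (axis j 1) + \<i> * frechet_derivative \<psi> (at x) (axis j \<i>))) w"
    by (simp add: wirtinger_bar_def[abs_def])
  also have "\<dots> = (1/2) * (smear h L (\<lambda>x. frechet_derivative \<psi> (at x) (axis j 1)) w
       + \<i> * smear h L (\<lambda>x. frechet_derivative \<psi> (at x) (axis j \<i>)) w)"
    unfolding smear_cmult by (subst smear_add) (auto intro!: continuous_intros c simp: smear_cmult)
  finally show "wirtinger_bar j (smear h L \<psi>) w = smear h L (wirtinger_bar j \<psi>) w"
    by (simp add: wirtinger_bar_def frechet_derivative_smear[OF assms(2)])
qed

text \<open>The truncation makes the kernel integrable with compact support. It is invisible below, since it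
  only acts on functions whose \<open>k\<close>-th coordinate is restricted to the unit disc. The normalizing constant
  is \<open>\<pi>\<close>, but only its being nonzero matters.\<close>

definition cauchy :: "complex \<Rightarrow> complex" where
  "cauchy \<zeta> = inverse (LINT z|lborel. bubble z) * (indicator (cball 0 2) \<zeta> * inverse \<zeta>)"

lemma bounded_linear_axis: "bounded_linear (axis k :: complex \<Rightarrow> complex ^ 'n::finite)"
  by (rule linear_conv_bounded_linear[THEN iffD1], rule linearI) (auto simp: vec_eq_iff axis_def)

lemma smearing_cauchy: "smearing cauchy (axis k :: complex \<Rightarrow> complex ^ 'n::finite) 2"
proof (rule smearing.intro)
  show "integrable lborel cauchy"
    unfolding cauchy_def[abs_def] by (intro integrable_mult_right integrable_inverse_cball)
  show "norm y \<le> 2" if "cauchy y \<noteq> 0" for y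
    using that by (auto simp: cauchy_def indicator_def split: if_splits)
qed (rule bounded_linear_axis)

text \<open>This is \<open>cauchy_pompeiu\<close> on the complex line through \<open>w\<close> in
  direction \<open>k\<close>. The bound on \<open>norm (w $ k) + \<sigma>\<close> puts the support
  of the restricted function inside the disc of radius 2, where the truncated kernel agrees with a
  multiple of 1/z.\<close>

lemma smear_cauchy_wirtinger_bar_cut:
  fixes \<phi> :: "complex ^ 'n::finite \<Rightarrow> complex"
  assumes m: "Ck (Suc 0) m" and \<phi>: "Ck (Suc 0) \<phi>"
    and supp: "\<And>z. norm z > \<sigma> \<Longrightarrow> m z = 0" and w: "norm (w $ k) + \<sigma> \<le> 2"
  shows "smear cauchy (axis k) (wirtinger_bar k (cut m k \<phi>)) w = - m (w $ k) * \<phi> w"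
proof -
  define \<psi> where "\<psi> = cut m k \<phi>"
  have \<psi>: "Ck (Suc 0) \<psi>" unfolding \<psi>_def cut_def[abs_def] by (intro Ck_mult Ck_nth m \<phi>)
  define g where "g \<zeta> = \<psi> (w + axis k \<zeta>)" for \<zeta>
  have g: "Ck (Suc 0) g" unfolding g_def[abs_def]
    by (rule Ck_compose_bounded_linear[OF bounded_linear_axis \<psi>])
  have "((\<lambda>\<zeta>. w + axis k \<zeta>) has_derivative axis k) (at \<zeta>)" for \<zeta>
    using has_derivative_add[OF has_derivative_const bounded_linear_imp_has_derivative[OF bounded_linear_axis]] by simp
  from has_derivative_compose[OF this Ck_SucD(1)[OF \<psi>]]
  have "(g has_derivative (\<lambda>v. frechet_derivative \<psi> (at (w + axis k \<zeta>)) (axis k v))) (at \<zeta>)" for \<zeta>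
    unfolding g_def[abs_def] .
  then have "frechet_derivative g (at \<zeta>) = (\<lambda>v. frechet_derivative \<psi> (at (w + axis k \<zeta>)) (axis k v))" for \<zeta>
    by (rule frechet_derivative_at[symmetric])
  then have wg: "wirt g \<zeta> = wirtinger_bar k \<psi> (w + axis k \<zeta>)" for \<zeta>
    by (simp add: wirt_def wirtinger_bar_def)
  have g0: "g \<zeta> = 0" if "norm \<zeta> > 2" for \<zeta>
  proof -
    have "norm (w $ k + \<zeta>) > \<sigma>"
      using that w norm_triangle_ineq4[of "w $ k + \<zeta>" "w $ k"] by simp
    then show ?thesis using supp by (simp add: g_def \<psi>_def cut_def)
  qed
  have C: "(LINT z|lborel. bubble z) \<noteq> 0" by (rule integral_bubble_nonzero)
  have "cauchy \<zeta> * wirt g \<zeta> = inverse (LINT z|lborel. bubble z) * (inverse \<zeta> * wirt g \<zeta>)" for \<zeta>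
  proof (cases "norm \<zeta> \<le> 2")
    case True
    then show ?thesis by (simp add: cauchy_def)
  next
    case False
    then have "wirt g \<zeta> = 0" by (simp add: wirt_def frechet_derivative_eq_0_outside[of 2 g, OF g0])
    then show ?thesis by simp
  qed
  then have "smear cauchy (axis k) (wirtinger_bar k \<psi>) w = (LINT \<zeta>|lborel. inverse (LINT z|lborel. bubble z) * (inverse \<zeta> * wirt g \<zeta>))"
    unfolding smear_def wg[symmetric] by (simp only:)
  also have "\<dots> = inverse (LINT z|lborel. bubble z) * (LINT \<zeta>|lborel. inverse \<zeta> * wirt g \<zeta>)"
    by (rule integral_mult_right_zero)
  also have "(LINT \<zeta>|lborel. inverse \<zeta> * wirt g \<zeta>) = - (LINT z|lborel. bubble z) * g 0"
    by (rule cauchy_pompeiu[OF g g0])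
  also have "g 0 = m (w $ k) * \<phi> w"
  proof -
    have ax: "axis k (0::complex) = (0 :: complex ^ 'n)" by simp
    show ?thesis by (simp add: g_def \<psi>_def cut_def ax)
  qed
  finally show ?thesis using C by (simp add: \<psi>_def)
qed

subsection \<open>Functions with support in a smaller polydisc\<close>

text \<open>The working form of \<open>Lr_c r polydisc\<close>: a Borel representative that vanishes
  at every point outside a smaller closed polydisc, so that supports can be followed through
  convolutions without null sets.\<close>

definition tame :: "ennreal \<Rightarrow> (complex ^ 'n::finite \<Rightarrow> complex) \<Rightarrow> bool" where
  "tame r f \<longleftrightarrow> f \<in> borel_measurable borel \<and> finite_norm r f \<and>
     (\<exists>\<rho>. 0 \<le> \<rho> \<and> \<rho> < 1 \<and> (\<forall>z. f z \<noteq> 0 \<longrightarrow> (\<forall>i. norm (z $ i) \<le> \<rho>)))"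

lemma tame_measurable: "tame r f \<Longrightarrow> f \<in> borel_measurable borel"
  by (simp add: tame_def)

lemma tame_mono:
  assumes "tame r g" "f \<in> borel_measurable borel" "\<And>x. norm (f x) \<le> norm (g x)"
  shows "tame r f"
proof -
  have "f z \<noteq> 0 \<Longrightarrow> g z \<noteq> 0" for z using assms(3)[of z] by auto
  moreover have "finite_norm r f"
    by (rule finite_norm_mono[of r g _ 1]) (use assms in \<open>auto simp: tame_def\<close>)
  ultimately show ?thesis using assms unfolding tame_def by blast
qed

lemma tame_uminus: "tame r f \<Longrightarrow> tame r (\<lambda>x. - f x)"
  by (rule tame_mono[of r f]) (auto simp: tame_def)

lemma tame_zero: "tame r (\<lambda>x. 0)"
  unfolding tame_def finite_norm_def by (auto intro: exI[of _ 0])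

lemma tame_add:
  assumes "tame r f" "tame r g"
  shows "tame r (\<lambda>x. f x + g x)"
proof -
  obtain a where a: "0 \<le> a" "a < 1" "\<And>z i. f z \<noteq> 0 \<Longrightarrow> norm (z $ i) \<le> a" using assms(1) by (auto simp: tame_def)
  obtain b where b: "0 \<le> b" "b < 1" "\<And>z i. g z \<noteq> 0 \<Longrightarrow> norm (z $ i) \<le> b" using assms(2) by (auto simp: tame_def)
  have "norm (z $ i) \<le> max a b" if "f z + g z \<noteq> 0" for z i
  proof -
    have "f z \<noteq> 0 \<or> g z \<noteq> 0" using that by auto
    then show ?thesis using a(3)[of z i] b(3)[of z i] by auto
  qed
  then have "\<exists>\<rho>. 0 \<le> \<rho> \<and> \<rho> < 1 \<and> (\<forall>z. f z + g z \<noteq> 0 \<longrightarrow> (\<forall>i. norm (z $ i) \<le> \<rho>))"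
    using a b by (intro exI[of _ "max a b"]) auto
  moreover have "finite_norm r (\<lambda>x. f x + g x)"
    using assms by (intro finite_norm_add) (auto simp: tame_def)
  ultimately show ?thesis using assms by (auto simp: tame_def)
qed

lemma norm_le_card:
  fixes z :: "complex ^ 'n::finite" and \<rho> :: real
  assumes "\<And>i. norm (z $ i) \<le> \<rho>"
  shows "norm z \<le> CARD('n) * \<rho>"
proof -
  have "norm z \<le> (\<Sum>i\<in>UNIV. norm (z $ i))" unfolding norm_vec_def by (rule L2_set_le_sum) simp
  also have "\<dots> \<le> (\<Sum>i\<in>(UNIV :: 'n set). \<rho>)" by (intro sum_mono assms)
  finally show ?thesis by simp
qed

text \<open>The support lies in a ball of finite measure, on which
  \<open>t \<le> 1 + t powr p\<close> reduces finite exponents to the first power.\<close>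

lemma tame_integrable:
  fixes f :: "complex ^ 'n::finite \<Rightarrow> complex"
  assumes f: "tame r f" and r: "r \<ge> 1"
  shows "integrable lborel f"
proof (rule integrableI_bounded)
  have [measurable]: "f \<in> borel_measurable borel" by (rule tame_measurable[OF f])
  then show "f \<in> borel_measurable lborel" by simp
  obtain \<rho> where \<rho>: "\<rho> < 1" "\<And>z i. f z \<noteq> 0 \<Longrightarrow> norm (z $ i) \<le> \<rho>" using f by (auto simp: tame_def)
  define B where "B = cball (0 :: complex ^ 'n) (CARD('n) * \<rho>)"
  have [measurable]: "B \<in> sets borel" unfolding B_def by simp
  have inB: "f z \<noteq> 0 \<Longrightarrow> z \<in> B" for z using norm_le_card[OF \<rho>(2)] by (simp add: B_def)
  have fin: "emeasure lborel B < \<infinity>" unfolding B_def by (rule emeasure_lborel_cball_finite)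
  show "(\<integral>\<^sup>+ x. ennreal (norm (f x)) \<partial>lborel) < \<infinity>"
  proof (cases "r = \<infinity>")
    case True
    then obtain M where M: "AE x in lborel. norm (f x) \<le> M" using f by (auto simp: tame_def finite_norm_def)
    have "(\<integral>\<^sup>+ x. ennreal (norm (f x)) \<partial>lborel) \<le> (\<integral>\<^sup>+ x. ennreal M * indicator B x \<partial>lborel)"
    proof (rule nn_integral_mono_AE, use M in eventually_elim)
      case (elim x)
      then show ?case using inB[of x] by (cases "f x = 0") (auto intro: ennreal_leI)
    qed
    also have "\<dots> = ennreal M * emeasure lborel B" by (rule nn_integral_cmult_indicator) measurable
    also have "\<dots> < \<infinity>" using fin by (simp add: ennreal_mult_less_top)
    finally show ?thesis .
  next
    case False
    define p where "p = enn2real r"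
    have p: "p \<ge> 1" using enn2real_mono[of 1 r] False r by (simp add: p_def less_top)
    have "(\<integral>\<^sup>+ x. ennreal (norm (f x)) \<partial>lborel) \<le> (\<integral>\<^sup>+ x. indicator B x + ennreal (norm (f x) powr p) \<partial>lborel)"
    proof (rule nn_integral_mono)
      fix x
      have "norm (f x) \<le> 1 + norm (f x) powr p" using le_add_powr[of "norm (f x)" 1 p] p by simp
      then have "ennreal (norm (f x)) \<le> 1 + ennreal (norm (f x) powr p)"
        by (metis ennreal_1 ennreal_leI ennreal_plus powr_ge_zero zero_le_one)
      then show "ennreal (norm (f x)) \<le> indicator B x + ennreal (norm (f x) powr p)"
        using inB[of x] by (cases "f x = 0") auto
    qed
    also have "\<dots> = emeasure lborel B + (\<integral>\<^sup>+ x. ennreal (norm (f x) powr p) \<partial>lborel)"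
      by (subst nn_integral_add) auto
    also have "\<dots> < \<infinity>" using fin f False by (simp add: tame_def finite_norm_def p_def)
    finally show ?thesis .
  qed
qed

definition pair :: "('a::euclidean_space \<Rightarrow> complex) \<Rightarrow> ('a \<Rightarrow> complex) \<Rightarrow> complex" where
  "pair f \<phi> = (LINT z|lborel. f z * \<phi> z)"

lemma integrable_tame_mult:
  assumes f: "tame r f" "r \<ge> 1" and \<phi>: "test_function \<phi>"
  shows "integrable lborel (\<lambda>z. f z * \<phi> z)"
proof -
  have [measurable]: "f \<in> borel_measurable borel" "\<phi> \<in> borel_measurable borel"
    by (rule tame_measurable[OF f(1)], rule test_function_measurable[OF \<phi>])
  obtain M where M: "\<And>x. norm (\<phi> x) \<le> M" using test_function_bounded[OF \<phi>] by blast
  show ?thesis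
  proof (rule Bochner_Integration.integrable_bound)
    show "integrable lborel (\<lambda>z. M * norm (f z))" using tame_integrable[OF f] by simp
    show "AE z in lborel. norm (f z * \<phi> z) \<le> norm (M * norm (f z))"
    proof (rule AE_I2)
      fix z
      have "norm (f z) * norm (\<phi> z) \<le> norm (f z) * \<bar>M\<bar>"
        using M[of z] by (intro mult_left_mono) auto
      then show "norm (f z * \<phi> z) \<le> norm (M * norm (f z))" by (simp add: norm_mult abs_mult mult.commute)
    qed
  qed simp
qed

lemma pair_add_left:
  "tame r f \<Longrightarrow> tame r g \<Longrightarrow> r \<ge> 1 \<Longrightarrow> test_function \<phi> \<Longrightarrow>
    pair (\<lambda>z. f z + g z) \<phi> = pair f \<phi> + pair g \<phi>"
  unfolding pair_def distrib_right by (intro Bochner_Integration.integral_add integrable_tame_mult)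

lemma pair_add_right:
  "tame r f \<Longrightarrow> r \<ge> 1 \<Longrightarrow> test_function \<phi> \<Longrightarrow> test_function \<psi> \<Longrightarrow>
    pair f (\<lambda>z. \<phi> z + \<psi> z) = pair f \<phi> + pair f \<psi>"
  unfolding pair_def distrib_left by (intro Bochner_Integration.integral_add integrable_tame_mult)

lemma pair_uminus_left: "pair (\<lambda>z. - f z) \<phi> = - pair f \<phi>"
  by (simp add: pair_def)

lemma pair_zero_left: "pair (\<lambda>z. 0) \<phi> = 0"
  by (simp add: pair_def)

abbreviation conv_cauchy :: "'n \<Rightarrow> (complex ^ 'n::finite \<Rightarrow> complex) \<Rightarrow> complex ^ 'n \<Rightarrow> complex" where
  "conv_cauchy k \<equiv> smearing.convolve cauchy (axis k)"

text \<open>The convolution moves the support only in coordinate \<open>k\<close>, where the factor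
  \<open>m\<close> brings it back to radius \<sigma>; the other coordinates keep the old radius
  \<rho>. This explains the new radius \<open>max \<rho> \<sigma>\<close>.\<close>

lemma tame_cut_conv_cauchy:
  fixes f :: "complex ^ 'n::finite \<Rightarrow> complex"
  assumes f: "tame r f" and r: "r \<ge> 1" and m: "continuous_on UNIV m"
    and \<sigma>: "0 \<le> \<sigma>" "\<sigma> < 1" and supp: "\<And>z. norm z > \<sigma> \<Longrightarrow> m z = 0"
  shows "tame r (cut m k (conv_cauchy k f))"
proof -
  interpret smearing cauchy "axis k :: complex \<Rightarrow> complex ^ 'n" 2 by (rule smearing_cauchy)
  have [measurable]: "f \<in> borel_measurable borel" by (rule tame_measurable[OF f])
  have [measurable]: "m \<in> borel_measurable borel" by (rule borel_measurable_continuous_onI[OF m])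
  have [measurable]: "convolve f \<in> borel_measurable borel" by (rule measurable_convolve) measurable
  have [measurable]: "(\<lambda>z :: complex ^ 'n. m (z $ k)) \<in> borel_measurable borel"
    by (intro borel_measurable_continuous_onI continuous_on_compose2[OF m] continuous_intros) auto
  have "compact (m ` cball 0 \<sigma>)" by (intro compact_continuous_image continuous_on_subset[OF m]) auto
  then obtain M where M: "\<forall>x\<in>m ` cball 0 \<sigma>. norm x \<le> M" using compact_imp_bounded bounded_iff by blast
  have bM: "norm (m z) \<le> \<bar>M\<bar>" for z
  proof (cases "norm z > \<sigma>")
    case False
    then have "norm (m z) \<le> M" using M by auto
    then show ?thesis by simp
  qed (simp add: supp)
  obtain \<rho> where \<rho>: "0 \<le> \<rho>" "\<rho> < 1" "\<And>z i. f z \<noteq> 0 \<Longrightarrow> norm (z $ i) \<le> \<rho>" using f by (auto simp: tame_def)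
  have "finite_norm r (cut m k (convolve f))"
  proof (rule finite_norm_mono)
    show "finite_norm r (convolve f)" by (rule finite_norm_convolve) (use f r in \<open>auto simp: tame_def\<close>)
    show "norm (cut m k (convolve f) x) \<le> \<bar>M\<bar> * norm (convolve f x)" for x
      unfolding cut_def norm_mult by (intro mult_right_mono bM) simp
  qed auto
  moreover have "norm (z $ i) \<le> max \<rho> \<sigma>" if "cut m k (convolve f) z \<noteq> 0" for z i
  proof (cases "i = k")
    case True
    then show ?thesis using that supp[of "z $ k"] by (cases "norm (z $ k) > \<sigma>") (auto simp: cut_def)
  next
    case False
    have "convolve f z \<noteq> 0" using that by (auto simp: cut_def)
    then obtain y where "f (z - axis k y) \<noteq> 0" by (rule convolve_nonzero)
    from \<rho>(3)[OF this, of i] show ?thesis using False by (simp add: axis_def)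
  qed
  moreover have "cut m k (convolve f) \<in> borel_measurable borel" unfolding cut_def[abs_def] by measurable
  ultimately show ?thesis unfolding tame_def using \<rho> \<sigma> by (intro conjI exI[of _ "max \<rho> \<sigma>"]) auto
qed

lemma pair_cut_conv_cauchy:
  fixes f :: "complex ^ 'n::finite \<Rightarrow> complex"
  assumes "tame r f" "r \<ge> 1" "\<And>k. Ck k m" "test_function \<phi>"
  shows "pair (cut m k (conv_cauchy k f)) \<phi> = pair f (smear cauchy (axis k) (cut m k \<phi>))"
proof -
  interpret smearing cauchy "axis k :: complex \<Rightarrow> complex ^ 'n" 2 by (rule smearing_cauchy)
  have t: "test_function (cut m k \<phi>)" by (intro test_function_cut assms)
  obtain M where M: "\<And>x. norm (cut m k \<phi> x) \<le> M" using test_function_bounded[OF t] by blast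
  have "pair (cut m k (convolve f)) \<phi> = (LINT z|lborel. convolve f z * cut m k \<phi> z)"
    unfolding pair_def cut_def by (simp add: mult_ac)
  also have "\<dots> = pair f (smear cauchy (axis k) (cut m k \<phi>))"
    unfolding pair_def
    by (rule integral_convolve_mult[OF tame_integrable[OF assms(1,2)] test_function_measurable[OF t] M])
  finally show ?thesis .
qed

subsection \<open>The homotopy in one variable\<close>

text \<open>\<open>X\<close> and \<open>Y\<close> are the transposes of \<open>T\<close> and
  \<open>S\<close>. A distributional derivative carries a minus sign, so the identities for the
  index \<open>k\<close> read, in order: T applied to the k-th derivative of f is f; S applied to it
  is 0; the k-th derivative of T f is f - S f. Those for other indices say that T and S commute with
  the derivative.\<close>

lemma exists_homotopy:
  fixes k :: "'n::finite" and \<rho> :: real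
  assumes \<rho>: "0 \<le> \<rho>" "\<rho> < 1" and r: "1 \<le> r"
  obtains T S :: "(complex ^ 'n \<Rightarrow> complex) \<Rightarrow> complex ^ 'n \<Rightarrow> complex"
    and X Y :: "(complex ^ 'n \<Rightarrow> complex) \<Rightarrow> complex ^ 'n \<Rightarrow> complex"
  where "\<And>f. tame r f \<Longrightarrow> tame r (T f)" "\<And>f. tame r f \<Longrightarrow> tame r (S f)"
    and "S (\<lambda>_. 0) = (\<lambda>_. 0)"
    and "\<And>\<phi>. test_function \<phi> \<Longrightarrow> test_function (X \<phi>)" "\<And>\<phi>. test_function \<phi> \<Longrightarrow> test_function (Y \<phi>)"
    and "\<And>f \<phi> j. tame r f \<Longrightarrow> test_function \<phi> \<Longrightarrow> j \<noteq> k \<Longrightarrow>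
      pair f (wirtinger_bar j (X \<phi>)) = pair (T f) (wirtinger_bar j \<phi>)"
    and "\<And>f \<phi> j. tame r f \<Longrightarrow> test_function \<phi> \<Longrightarrow> j \<noteq> k \<Longrightarrow>
      pair f (wirtinger_bar j (Y \<phi>)) = pair (S f) (wirtinger_bar j \<phi>)"
    and "\<And>f \<phi>. tame r f \<Longrightarrow> test_function \<phi> \<Longrightarrow> (\<And>z. f z \<noteq> 0 \<Longrightarrow> norm (z $ k) \<le> \<rho>) \<Longrightarrow>
      pair f (wirtinger_bar k (X \<phi>)) = - pair f \<phi>"
    and "\<And>f \<phi>. tame r f \<Longrightarrow> test_function \<phi> \<Longrightarrow> (\<And>z. f z \<noteq> 0 \<Longrightarrow> norm (z $ k) \<le> \<rho>) \<Longrightarrow>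
      pair f (wirtinger_bar k (Y \<phi>)) = 0"
    and "\<And>f \<phi>. tame r f \<Longrightarrow> test_function \<phi> \<Longrightarrow> (\<And>z. f z \<noteq> 0 \<Longrightarrow> norm (z $ k) \<le> \<rho>) \<Longrightarrow>
      pair (T f) (wirtinger_bar k \<phi>) = - pair f \<phi> + pair (S f) \<phi>"
proof -
  \<comment> \<open>The cutoff is to be 1 up to the larger radius \<rho>', so that its derivative
    vanishes on an open set containing the whole closed disc of radius \<rho>.\<close>
  define \<rho>' where "\<rho>' = (1 + \<rho>) / 2"
  define \<sigma> where "\<sigma> = (1 + \<rho>') / 2"
  have \<sigma>: "\<rho> < \<rho>'" "0 \<le> \<rho>'" "\<rho>' < \<sigma>" "0 \<le> \<sigma>" "\<sigma> < 1" using \<rho> by (auto simp: \<sigma>_def \<rho>'_def)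
  obtain m :: "complex \<Rightarrow> complex" where m: "\<And>k. Ck k m" "\<And>x. norm x \<le> \<rho>' \<Longrightarrow> m x = 1" "\<And>x. norm x \<ge> \<sigma> \<Longrightarrow> m x = 0"
    using exists_cutoff[of \<rho>' \<sigma>] \<sigma> by blast
  define m' where "m' z = - wirt m z" for z
  have m': "Ck k m'" for k unfolding m'_def[abs_def] by (intro Ck_uminus Ck_wirt m)
  have m'1: "m' z = 0" if "norm z < \<rho>'" for z
    using wirt_eq_0[of "ball 0 \<rho>'" z m 1] m(2) that by (auto simp: m'_def)
  have m'0: "m' z = 0" if "norm z > \<sigma>" for z
    using wirt_eq_0[of "- cball 0 \<sigma>" z m 0] m(3) that by (auto simp: m'_def)
  have m0: "m z = 0" if "norm z > \<sigma>" for z using m(3)[of z] that by simp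
  interpret smearing cauchy "axis k :: complex \<Rightarrow> complex ^ 'n" 2 by (rule smearing_cauchy)
  define P where "P m \<phi> = smear cauchy (axis k) (cut m k \<phi>)" for m and \<phi> :: "complex ^ 'n \<Rightarrow> complex"
  have tP: "test_function (P c \<phi>)" if "test_function \<phi>" "\<And>k. Ck k c" for c \<phi>
    unfolding P_def by (intro test_function_smear test_function_cut that)
  have Ck1: "Ck (Suc 0) \<phi>" if "test_function \<phi>" for \<phi> :: "complex ^ 'n \<Rightarrow> complex" using that by (simp add: test_function_iff)
  have dual: "pair (cut c k (conv_cauchy k f)) \<phi> = pair f (P c \<phi>)"
    if "tame r f" "test_function \<phi>" "\<And>k. Ck k c" for c f \<phi>
    unfolding P_def by (rule pair_cut_conv_cauchy) (use that r in auto)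
  have dP: "wirtinger_bar j (P c \<phi>) = smear cauchy (axis k) (wirtinger_bar j (cut c k \<phi>))"
    if "test_function \<phi>" "\<And>k. Ck k c" for c \<phi> j
    unfolding P_def by (intro wirtinger_bar_smear[OF smearing_cauchy] Ck1 test_function_cut that)
  have dPj: "wirtinger_bar j (P c \<phi>) = P c (wirtinger_bar j \<phi>)"
    if "test_function \<phi>" "\<And>k. Ck k c" "j \<noteq> k" for c \<phi> j
    unfolding dP[OF that(1,2)] unfolding P_def by (subst wirtinger_bar_cut_neq) (use that Ck1 in auto)
  have dPk: "pair f (wirtinger_bar k (P c \<phi>)) = (LINT z|lborel. f z * (- c (z $ k) * \<phi> z))"
    if "test_function \<phi>" "\<And>k. Ck k c" "\<And>z. norm z > \<sigma> \<Longrightarrow> c z = 0" "\<And>z. f z \<noteq> 0 \<Longrightarrow> norm (z $ k) \<le> \<rho>" for c f \<phi>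
    unfolding pair_def
  proof (rule Bochner_Integration.integral_cong)
    fix z
    show "f z * wirtinger_bar k (P c \<phi>) z = f z * (- c (z $ k) * \<phi> z)"
    proof (cases "f z = 0")
      case False
      \<comment> \<open>On the support of \<open>f\<close> the k-th coordinate has norm at most
        \<rho>, and \<rho> + \<sigma> < 2, so the truncation of the kernel is not felt.\<close>
      have "wirtinger_bar k (P c \<phi>) z = - c (z $ k) * \<phi> z"
        unfolding dP[OF that(1,2)]
        by (rule smear_cauchy_wirtinger_bar_cut[OF that(2) Ck1[OF that(1)] that(3)])
          (use that(4)[OF False] \<rho> \<sigma> in auto)
      then show ?thesis by simp
    qed simp
  qed simp
  show ?thesis
  proof (rule that[of "\<lambda>f. cut m k (conv_cauchy k f)" "\<lambda>f. cut m' k (conv_cauchy k f)" "P m" "P m'"])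
    fix f :: "complex ^ 'n \<Rightarrow> complex" assume f: "tame r f"
    show "tame r (cut m k (conv_cauchy k f))"
      by (rule tame_cut_conv_cauchy[OF f r Ck_imp_continuous[OF m(1)] \<sigma>(4,5) m0])
    show "tame r (cut m' k (conv_cauchy k f))"
      by (rule tame_cut_conv_cauchy[OF f r Ck_imp_continuous[OF m'] \<sigma>(4,5) m'0])
  next
    show "cut m' k (conv_cauchy k (\<lambda>_. 0)) = (\<lambda>_. 0)"
      by (simp add: cut_def[abs_def] convolve_def)
  next
    fix \<phi> :: "complex ^ 'n \<Rightarrow> complex" assume "test_function \<phi>"
    then show "test_function (P m \<phi>)" "test_function (P m' \<phi>)" by (intro tP m(1) m' | assumption)+
  next
    fix f \<phi> :: "complex ^ 'n \<Rightarrow> complex" and j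
    assume *: "tame r f" "test_function \<phi>" "j \<noteq> k"
    show "pair f (wirtinger_bar j (P m \<phi>)) = pair (cut m k (conv_cauchy k f)) (wirtinger_bar j \<phi>)"
      using * by (simp add: dPj m(1) dual test_function_wirtinger_bar)
    show "pair f (wirtinger_bar j (P m' \<phi>)) = pair (cut m' k (conv_cauchy k f)) (wirtinger_bar j \<phi>)"
      using * by (simp add: dPj m' dual test_function_wirtinger_bar)
  next
    fix f \<phi> :: "complex ^ 'n \<Rightarrow> complex"
    assume f: "tame r f" and \<phi>: "test_function \<phi>" and supp: "\<And>z. f z \<noteq> 0 \<Longrightarrow> norm (z $ k) \<le> \<rho>"
    have "pair f (wirtinger_bar k (P m \<phi>)) = (LINT z|lborel. f z * (- m (z $ k) * \<phi> z))"
      by (rule dPk[OF \<phi> m(1) m0 supp])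
    also have "\<dots> = (LINT z|lborel. - (f z * \<phi> z))"
    proof (rule Bochner_Integration.integral_cong)
      fix z
      show "f z * (- m (z $ k) * \<phi> z) = - (f z * \<phi> z)"
        using supp[of z] m(2)[of "z $ k"] \<sigma>(1) by (cases "f z = 0") auto
    qed simp
    finally show X: "pair f (wirtinger_bar k (P m \<phi>)) = - pair f \<phi>" by (simp add: pair_def)
    have "pair f (wirtinger_bar k (P m' \<phi>)) = (LINT z|lborel. f z * (- m' (z $ k) * \<phi> z))"
      by (rule dPk[OF \<phi> m' m'0 supp])
    also have "\<dots> = (LINT z|(lborel :: (complex ^ 'n) measure). 0)"
    proof (rule Bochner_Integration.integral_cong)
      fix z
      show "f z * (- m' (z $ k) * \<phi> z) = 0"
        using supp[of z] m'1[of "z $ k"] \<sigma>(1) by (cases "f z = 0") auto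
    qed simp
    finally show "pair f (wirtinger_bar k (P m' \<phi>)) = 0" by simp
    have tk: "test_function (wirtinger_bar k \<phi>)" by (rule test_function_wirtinger_bar[OF \<phi>])
    \<comment> \<open>Moving the derivative past multiplication by \<open>m\<close> leaves a term
      with the derivative of \<open>m\<close>; it is the source of the error operator
      \<open>S\<close>.\<close>
    have "wirtinger_bar k (P m \<phi>) = (\<lambda>z. P m (wirtinger_bar k \<phi>) z + P (wirt m) \<phi> z)"
      unfolding dP[OF \<phi> m(1)] wirtinger_bar_cut_eq[OF m(1) Ck1[OF \<phi>]] unfolding P_def
      by (intro ext smear_add test_function_continuous test_function_cut tk \<phi> m(1) Ck_wirt)
    moreover have "P (wirt m) \<phi> = (\<lambda>z. - P m' \<phi> z)"
    proof
      fix z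
      have "cut m' k \<phi> = (\<lambda>z. (-1) * cut (wirt m) k \<phi> z)" by (auto simp: cut_def m'_def)
      then show "P (wirt m) \<phi> z = - P m' \<phi> z" unfolding P_def by (simp only: smear_cmult) simp
    qed
    ultimately have X': "pair f (wirtinger_bar k (P m \<phi>)) = pair f (\<lambda>z. P m (wirtinger_bar k \<phi>) z + P (wirt m) \<phi> z)"
      and e: "pair f (P (wirt m) \<phi>) = - pair f (P m' \<phi>)"
      by (simp_all add: pair_def)
    note X'
    also have "pair f (\<lambda>z. P m (wirtinger_bar k \<phi>) z + P (wirt m) \<phi> z) = pair f (P m (wirtinger_bar k \<phi>)) + pair f (P (wirt m) \<phi>)"
      by (intro pair_add_right[OF f r] tP tk \<phi> m(1) Ck_wirt)
    finally have "pair f (P m (wirtinger_bar k \<phi>)) = - pair f \<phi> + pair f (P m' \<phi>)"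
      using X e by (simp add: algebra_simps)
    then show "pair (cut m k (conv_cauchy k f)) (wirtinger_bar k \<phi>) = - pair f \<phi> + pair (cut m' k (conv_cauchy k f)) \<phi>"
      by (simp add: dual[OF f tk m(1)] dual[OF f \<phi> m'])
  qed
qed

section \<open>Solving the divergence equation one coordinate at a time\<close>

definition divfree :: "('n \<Rightarrow> complex ^ 'n::finite \<Rightarrow> complex) \<Rightarrow> bool" where
  "divfree u \<longleftrightarrow> (\<forall>\<phi>. test_function \<phi> \<longrightarrow> (\<Sum>j\<in>UNIV. pair (u j) (wirtinger_bar j \<phi>)) = 0)"

text \<open>The last identity says that \<open>u j\<close> is \<open>u' j\<close> plus the
  divergence of \<open>b\<close> in its first index. For \<open>j \<noteq> k\<close> it is the
  formula for the k-th derivative of \<open>T (u j)\<close>; only for \<open>j = k\<close> is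
  \<open>divfree u\<close> needed. Components that are already zero stay zero, so the step can be
  iterated.\<close>

lemma remove_component:
  fixes u :: "'n \<Rightarrow> complex ^ 'n::finite \<Rightarrow> complex"
  assumes r: "1 \<le> r" and tame: "\<And>j. tame r (u j)" and div: "divfree u"
  obtains b u' where "\<And>i j. tame r (b i j)" "\<And>i j z. b i j z = - b j i z"
    "\<And>j. tame r (u' j)" "divfree u'" "u' k = (\<lambda>_. 0)" "\<And>j. u j = (\<lambda>_. 0) \<Longrightarrow> u' j = (\<lambda>_. 0)"
    "\<And>\<phi> j. test_function \<phi> \<Longrightarrow> pair (u j) \<phi> = pair (u' j) \<phi> - (\<Sum>i\<in>UNIV. pair (b i j) (wirtinger_bar i \<phi>))"
proof -
  have "\<forall>j. \<exists>\<rho>. 0 \<le> \<rho> \<and> \<rho> < 1 \<and> (\<forall>z. u j z \<noteq> 0 \<longrightarrow> (\<forall>i. norm (z $ i) \<le> \<rho>))"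
    using tame by (auto simp: tame_def)
  then obtain R where R: "\<And>j. 0 \<le> R j" "\<And>j. R j < 1" "\<And>j z i. u j z \<noteq> 0 \<Longrightarrow> norm (z $ i) \<le> R j" by metis
  \<comment> \<open>One radius for all components, so that the same \<open>T\<close> and
    \<open>S\<close> act on each of them.\<close>
  define \<rho> where "\<rho> = Max (range R)"
  have R\<rho>: "R j \<le> \<rho>" for j unfolding \<rho>_def by (intro Max_ge) auto
  have "\<rho> \<in> range R" unfolding \<rho>_def by (intro Max_in) auto
  then have \<rho>: "0 \<le> \<rho>" "\<rho> < 1" using R by auto
  have supp: "u j z \<noteq> 0 \<Longrightarrow> norm (z $ k) \<le> \<rho>" for j z using R(3)[of j z k] R\<rho>[of j] by simp
  obtain T S X Y where TS: "\<And>f. tame r f \<Longrightarrow> tame r (T f)" "\<And>f. tame r f \<Longrightarrow> tame r (S f)"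
    and S0: "S (\<lambda>_. 0) = (\<lambda>_. 0)"
    and XY: "\<And>\<phi>. test_function \<phi> \<Longrightarrow> test_function (X \<phi>)" "\<And>\<phi>. test_function \<phi> \<Longrightarrow> test_function (Y \<phi>)"
    and Xj: "\<And>f \<phi> j. tame r f \<Longrightarrow> test_function \<phi> \<Longrightarrow> j \<noteq> k \<Longrightarrow>
      pair f (wirtinger_bar j (X \<phi>)) = pair (T f) (wirtinger_bar j \<phi>)"
    and Yj: "\<And>f \<phi> j. tame r f \<Longrightarrow> test_function \<phi> \<Longrightarrow> j \<noteq> k \<Longrightarrow>
      pair f (wirtinger_bar j (Y \<phi>)) = pair (S f) (wirtinger_bar j \<phi>)"
    and Xk: "\<And>f \<phi>. tame r f \<Longrightarrow> test_function \<phi> \<Longrightarrow> (\<And>z. f z \<noteq> 0 \<Longrightarrow> norm (z $ k) \<le> \<rho>) \<Longrightarrow>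
      pair f (wirtinger_bar k (X \<phi>)) = - pair f \<phi>"
    and Yk: "\<And>f \<phi>. tame r f \<Longrightarrow> test_function \<phi> \<Longrightarrow> (\<And>z. f z \<noteq> 0 \<Longrightarrow> norm (z $ k) \<le> \<rho>) \<Longrightarrow>
      pair f (wirtinger_bar k (Y \<phi>)) = 0"
    and Tk: "\<And>f \<phi>. tame r f \<Longrightarrow> test_function \<phi> \<Longrightarrow> (\<And>z. f z \<noteq> 0 \<Longrightarrow> norm (z $ k) \<le> \<rho>) \<Longrightarrow>
      pair (T f) (wirtinger_bar k \<phi>) = - pair f \<phi> + pair (S f) \<phi>"
  proof (rule exists_homotopy[OF \<rho> r, of k], goal_cases)
    case (1 T S X Y)
    show ?case by (rule that[of T S X Y]; fact 1)
  qed
  have split: "(\<Sum>j\<in>UNIV. g j) = g k + (\<Sum>j\<in>UNIV - {k}. g j)" for g :: "'n \<Rightarrow> complex"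
    by (rule sum.remove) auto
  define u' where "u' j = (if j = k then (\<lambda>_. 0) else S (u j))" for j
  define b where "b i j = (if i = k \<and> j \<noteq> k then T (u j) else if j = k \<and> i \<noteq> k then (\<lambda>z. - T (u i) z) else (\<lambda>_. 0))" for i j
  show ?thesis
  proof (rule that[of b u'])
    show "tame r (b i j)" for i j
      unfolding b_def by (auto intro: TS tame tame_uminus tame_zero)
    show "b i j z = - b j i z" for i j z by (auto simp: b_def)
    show "tame r (u' j)" for j unfolding u'_def by (auto intro: TS tame tame_zero)
    show "u' k = (\<lambda>_. 0)" by (simp add: u'_def)
    show "u j = (\<lambda>_. 0) \<Longrightarrow> u' j = (\<lambda>_. 0)" for j by (simp add: u'_def S0)
    show "divfree u'"
      unfolding divfree_def
    proof (intro allI impI)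
      fix \<phi> :: "complex ^ 'n \<Rightarrow> complex" assume \<phi>: "test_function \<phi>"
      \<comment> \<open>Testing the divergence of \<open>u\<close> on \<open>Y \<phi>\<close>
        amounts to applying \<open>S\<close> to it; the k-th term drops out.\<close>
      have "0 = (\<Sum>j\<in>UNIV. pair (u j) (wirtinger_bar j (Y \<phi>)))"
        using div XY(2)[OF \<phi>] by (simp add: divfree_def)
      also have "\<dots> = pair (u k) (wirtinger_bar k (Y \<phi>)) + (\<Sum>j\<in>UNIV - {k}. pair (u j) (wirtinger_bar j (Y \<phi>)))"
        by (rule split)
      also have "pair (u k) (wirtinger_bar k (Y \<phi>)) = 0" by (rule Yk[OF tame \<phi> supp])
      also have "(\<Sum>j\<in>UNIV - {k}. pair (u j) (wirtinger_bar j (Y \<phi>))) = (\<Sum>j\<in>UNIV - {k}. pair (u' j) (wirtinger_bar j \<phi>))"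
        by (rule sum.cong) (auto simp: u'_def Yj[OF tame \<phi>])
      finally show "(\<Sum>j\<in>UNIV. pair (u' j) (wirtinger_bar j \<phi>)) = 0"
        unfolding split by (simp add: u'_def pair_zero_left)
    qed
  next
    fix \<phi> :: "complex ^ 'n \<Rightarrow> complex" and j assume \<phi>: "test_function \<phi>"
    show "pair (u j) \<phi> = pair (u' j) \<phi> - (\<Sum>i\<in>UNIV. pair (b i j) (wirtinger_bar i \<phi>))"
    proof (cases "j = k")
      case False
      have "(\<Sum>i\<in>UNIV - {k}. pair (b i j) (wirtinger_bar i \<phi>)) = 0"
        using False by (intro sum.neutral) (auto simp: b_def pair_zero_left)
      then have "(\<Sum>i\<in>UNIV. pair (b i j) (wirtinger_bar i \<phi>)) = pair (T (u j)) (wirtinger_bar k \<phi>)"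
        unfolding split using False by (simp add: b_def)
      then show ?thesis using Tk[OF tame \<phi> supp] False by (simp add: u'_def)
    next
      case True
      \<comment> \<open>Testing on \<open>X \<phi>\<close> amounts to applying \<open>T\<close>; the
        k-th term returns \<open>u k\<close>, and the others are the entries \<open>b i k\<close> up
        to sign.\<close>
      have "0 = (\<Sum>i\<in>UNIV. pair (u i) (wirtinger_bar i (X \<phi>)))"
        using div XY(1)[OF \<phi>] by (simp add: divfree_def)
      also have "\<dots> = pair (u k) (wirtinger_bar k (X \<phi>)) + (\<Sum>i\<in>UNIV - {k}. pair (u i) (wirtinger_bar i (X \<phi>)))"
        by (rule split)
      also have "pair (u k) (wirtinger_bar k (X \<phi>)) = - pair (u k) \<phi>" by (rule Xk[OF tame \<phi> supp])
      also have "(\<Sum>i\<in>UNIV - {k}. pair (u i) (wirtinger_bar i (X \<phi>))) = (\<Sum>i\<in>UNIV - {k}. - pair (b i k) (wirtinger_bar i \<phi>))"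
        by (rule sum.cong) (auto simp: b_def pair_uminus_left Xj[OF tame \<phi>])
      finally show ?thesis using True unfolding split 
        by (simp add: u'_def b_def pair_zero_left sum_negf) (metis add.inverse_inverse)
    qed
  qed
qed

text \<open>Induction over a set \<open>K\<close> outside of which all components vanish. Each
  application of \<open>remove_component\<close> takes one index out of \<open>K\<close>, and the
  tensors obtained on the way add up.\<close>

lemma exists_potential:
  fixes u :: "'n \<Rightarrow> complex ^ 'n::finite \<Rightarrow> complex"
  assumes r: "1 \<le> r" and "\<And>j. tame r (u j)" "divfree u"
  obtains b where "\<And>i j. tame r (b i j)" "\<And>i j z. b i j z = - b j i z"
    "\<And>\<phi> j. test_function \<phi> \<Longrightarrow> pair (u j) \<phi> = - (\<Sum>i\<in>UNIV. pair (b i j) (wirtinger_bar i \<phi>))"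
proof -
  have "\<exists>b. (\<forall>i j. tame r (b i j)) \<and> (\<forall>i j z. b i j z = - b j i z) \<and>
      (\<forall>\<phi> j. test_function \<phi> \<longrightarrow> pair (u j) \<phi> = - (\<Sum>i\<in>UNIV. pair (b i j) (wirtinger_bar i \<phi>)))"
    if "finite K" "\<And>j. tame r (u j)" "divfree u" "\<And>j. j \<notin> K \<Longrightarrow> u j = (\<lambda>_. 0)"
    for K and u :: "'n \<Rightarrow> complex ^ 'n \<Rightarrow> complex"
    using that
  proof (induction K arbitrary: u rule: finite_induct)
    case empty
    have "\<forall>i j. tame r ((\<lambda>_ _ _. 0) i j :: complex ^ 'n \<Rightarrow> complex)" by (simp add: tame_zero)
    then show ?case using empty by (intro exI[of _ "\<lambda>_ _ _. 0"]) (simp add: pair_zero_left)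
  next
    case (insert k K)
    obtain b u' where b: "\<And>i j. tame r (b i j)" "\<And>i j z. b i j z = - b j i z"
      and u': "\<And>j. tame r (u' j)" "divfree u'" "u' k = (\<lambda>_. 0)" "\<And>j. u j = (\<lambda>_. 0) \<Longrightarrow> u' j = (\<lambda>_. 0)"
      and eq: "\<And>\<phi> j. test_function \<phi> \<Longrightarrow> pair (u j) \<phi> = pair (u' j) \<phi> - (\<Sum>i\<in>UNIV. pair (b i j) (wirtinger_bar i \<phi>))"
    proof (rule remove_component[OF r insert.prems(1,2), of k], goal_cases)
      case (1 b u')
      show ?case by (rule that[of b u']; fact 1)
    qed
    have "u' j = (\<lambda>_. 0)" if "j \<notin> K" for j
      using that u'(3) u'(4)[OF insert.prems(3)] by (cases "j = k") auto
    from insert.IH[OF u'(1,2) this] obtain b' where b'_all: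
      "\<forall>i j. tame r (b' i j)" "\<forall>i j z. b' i j z = - b' j i z"
      "\<forall>\<phi> j. test_function \<phi> \<longrightarrow> pair (u' j) \<phi> = - (\<Sum>i\<in>UNIV. pair (b' i j) (wirtinger_bar i \<phi>))"
      by blast
    have b': "tame r (b' i j)" "b' i j z = - b' j i z" for i j z
      using b'_all(1,2) by blast+
    have eq': "pair (u' j) \<phi> = - (\<Sum>i\<in>UNIV. pair (b' i j) (wirtinger_bar i \<phi>))" if "test_function \<phi>" for \<phi> j
      using b'_all(3) that by blast
    show ?case
    proof (intro exI[of _ "\<lambda>i j z. b i j z + b' i j z"] conjI allI impI)
      show "tame r (\<lambda>z. b i j z + b' i j z)" for i j by (intro tame_add b b')
      show "b i j z + b' i j z = - (b j i z + b' j i z)" for i j z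
        using b(2)[of i j z] b'(2)[of i j z] by simp
      fix \<phi> :: "complex ^ 'n \<Rightarrow> complex" and j assume \<phi>: "test_function \<phi>"
      have "pair (\<lambda>z. b i j z + b' i j z) (wirtinger_bar i \<phi>) = pair (b i j) (wirtinger_bar i \<phi>) + pair (b' i j) (wirtinger_bar i \<phi>)" for i
        by (rule pair_add_left[OF b(1) b'(1) r test_function_wirtinger_bar[OF \<phi>]])
      then show "pair (u j) \<phi> = - (\<Sum>i\<in>UNIV. pair (\<lambda>z. b i j z + b' i j z) (wirtinger_bar i \<phi>))"
        by (simp add: sum.distrib eq[OF \<phi>] eq'[OF \<phi>])
    qed
  qed
  from this[of UNIV u, OF finite assms(2,3)] obtain b where
      "\<forall>i j. tame r (b i j)" "\<forall>i j z. b i j z = - b j i z"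
      "\<forall>\<phi> j. test_function \<phi> \<longrightarrow> pair (u j) \<phi> = - (\<Sum>i\<in>UNIV. pair (b i j) (wirtinger_bar i \<phi>))"
    by auto
  then show ?thesis by (intro that[of b]) blast+
qed

subsection \<open>Borel representatives\<close>

lemma closed_ess_support: "closed (ess_support f)"
  unfolding ess_support_def by (intro closed_Compl open_Union) auto

text \<open>The complement of the essential support is a possibly uncountable union of open sets;
  the Lindeloef property reduces it to a countable one, for which the null sets can be
  collected.\<close>

lemma AE_eq_0_outside_ess_support:
  fixes f :: "'a::euclidean_space \<Rightarrow> complex"
  shows "AE x in lebesgue. x \<notin> ess_support f \<longrightarrow> f x = 0"
proof -
  define F where "F = {U. open U \<and> (AE x in lebesgue. x \<in> U \<longrightarrow> f x = 0)}"
  obtain F' where F': "F' \<subseteq> F" "countable F'" "\<Union>F' = \<Union>F"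
    using Lindelof[of F] unfolding F_def by auto
  have "AE x in lebesgue. \<forall>U\<in>F'. x \<in> U \<longrightarrow> f x = 0"
    using F'(1) by (subst AE_ball_countable[OF F'(2)]) (auto simp: F_def)
  then show ?thesis
  proof eventually_elim
    case (elim x)
    have "ess_support f = - \<Union>F'" by (simp add: ess_support_def F'(3) F_def)
    then show ?case using elim by auto
  qed
qed

lemma tame_imp_Lr_c:
  fixes f :: "complex ^ 'n::finite \<Rightarrow> complex"
  assumes "tame r f"
  shows "f \<in> Lr_c r polydisc"
proof -
  have [measurable]: "f \<in> borel_measurable borel" and fin: "finite_norm r f"
    using assms by (auto simp: tame_def)
  have fl: "f \<in> borel_measurable lebesgue" by (rule measurable_completion) simp
  obtain \<rho> where \<rho>: "\<rho> < 1" "\<And>z i. f z \<noteq> 0 \<Longrightarrow> norm (z $ i) \<le> \<rho>" using assms by (auto simp: tame_def)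
  define C where "C = {z :: complex ^ 'n. \<forall>i. norm (z $ i) \<le> \<rho>}"
  have "closed C" unfolding C_def by (intro closed_Collect_all closed_Collect_le continuous_intros)
  have sub: "ess_support f \<subseteq> C"
  proof -
    have "f x = 0" if "x \<in> - C" for x using that \<rho>(2)[of x] by (auto simp: C_def)
    then have "- C \<in> {U. open U \<and> (AE x in lebesgue. x \<in> U \<longrightarrow> f x = 0)}"
      using \<open>closed C\<close> by (auto simp: open_Compl)
    then show ?thesis unfolding ess_support_def by blast
  qed
  have "bounded C" unfolding bounded_iff C_def using norm_le_card by blast
  then have "bounded (ess_support f)" using sub by (rule bounded_subset)
  then have "compact (ess_support f)" by (simp add: compact_eq_bounded_closed closed_ess_support)
  moreover have "C \<subseteq> polydisc"
    using \<rho>(1) by (auto simp: C_def polydisc_def intro: le_less_trans)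
  with sub have "ess_support f \<subseteq> polydisc" by (rule order_trans)
  moreover have "Lr_norm r f < \<infinity>"
  proof (cases "r = \<infinity>")
    case True
    then obtain M where M: "AE x in lborel. norm (f x) \<le> M" using fin by (auto simp: finite_norm_def)
    have "AE x in lebesgue. ennreal (norm (f x)) \<le> ennreal M"
      by (rule AE_completion, use M in eventually_elim) (rule ennreal_leI)
    then have "esssup lebesgue (\<lambda>x. ennreal (norm (f x))) \<le> ennreal M"
      by (intro esssup_I measurable_completion) simp
    then show ?thesis using True by (simp add: Lr_norm_def order_le_less_trans[OF _ ennreal_less_top])
  next
    case False
    have "(\<integral>\<^sup>+ x. ennreal (norm (f x) powr enn2real r) \<partial>lebesgue) = (\<integral>\<^sup>+ x. ennreal (norm (f x) powr enn2real r) \<partial>lborel)"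
      by (rule nn_integral_completion)
    then show ?thesis using fin False by (simp add: Lr_norm_def finite_norm_def Let_def)
  qed
  ultimately show ?thesis using fl by (simp add: Lr_c_def Lr_space_def)
qed

text \<open>The norm of each coordinate attains its maximum on \<open>K\<close>, with a value below
  1, and there are finitely many coordinates.\<close>

lemma compact_subset_polydisc:
  assumes "compact K" "K \<subseteq> (polydisc :: (complex ^ 'n::finite) set)"
  obtains \<rho> where "0 \<le> \<rho>" "\<rho> < 1" "\<And>z i. z \<in> K \<Longrightarrow> norm (z $ i) \<le> \<rho>"
proof (cases "K = {}")
  case True
  then show ?thesis using that[of 0] by simp
next
  case False
  have "\<exists>x\<in>K. \<forall>z\<in>K. norm (z $ i) \<le> norm (x $ i)" for i
    by (rule continuous_attains_sup[OF assms(1) False]) (intro continuous_intros)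
  then obtain x where x: "\<And>i. x i \<in> K" "\<And>i z. z \<in> K \<Longrightarrow> norm (z $ i) \<le> norm (x i $ i)" by metis
  define \<rho> where "\<rho> = Max (range (\<lambda>i. norm (x i $ i)))"
  have "norm (x i $ i) \<le> \<rho>" for i unfolding \<rho>_def by (intro Max_ge) auto
  then have le: "norm (z $ i) \<le> \<rho>" if "z \<in> K" for z i using x(2)[OF that] order_trans by blast
  have "\<rho> \<in> range (\<lambda>i. norm (x i $ i))" unfolding \<rho>_def by (intro Max_in) auto
  then obtain i where "\<rho> = norm (x i $ i)" by blast
  then show ?thesis using that[of \<rho>] le x(1)[of i] assms(2) by (auto simp: polydisc_def)
qed

lemma Lr_c_imp_tame:
  fixes f :: "complex ^ 'n::finite \<Rightarrow> complex"
  assumes f: "f \<in> Lr_c r polydisc"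
  obtains g where "tame r g" "AE x in lebesgue. f x = g x"
proof -
  have fl: "f \<in> borel_measurable lebesgue" and norm: "Lr_norm r f < \<infinity>"
    and K: "compact (ess_support f)" "ess_support f \<subseteq> polydisc"
    using f by (auto simp: Lr_c_def Lr_space_def)
  obtain \<rho> where \<rho>: "0 \<le> \<rho>" "\<rho> < 1" "\<And>z i. z \<in> ess_support f \<Longrightarrow> norm (z $ i) \<le> \<rho>"
    using compact_subset_polydisc[OF K] by blast
  have "(\<lambda>x. Re (f x)) \<in> borel_measurable lebesgue" "(\<lambda>x. Im (f x)) \<in> borel_measurable lebesgue"
    using fl by measurable
  from this[THEN completion_ex_borel_measurable_real] obtain a b
    where [measurable]: "a \<in> borel_measurable lborel" "b \<in> borel_measurable lborel"
      and a: "AE x in lborel. Re (f x) = a x" and b: "AE x in lborel. Im (f x) = b x" by blast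
  define C where "C = {z :: complex ^ 'n. \<forall>i. norm (z $ i) \<le> \<rho>}"
  have "closed C" unfolding C_def by (intro closed_Collect_all closed_Collect_le continuous_intros)
  then have [measurable]: "C \<in> sets borel" by simp
  \<comment> \<open>The indicator turns vanishing almost everywhere outside the essential support
    into vanishing at every point outside \<open>C\<close>, and changes \<open>f\<close> only on a
    null set.\<close>
  define g where "g z = indicator C z * (of_real (a z) + \<i> * of_real (b z))" for z
  have "(\<lambda>z. complex_of_real (indicator C z) * (of_real (a z) + \<i> * of_real (b z))) \<in> borel_measurable borel"
    by measurable
  moreover have "(\<lambda>z. complex_of_real (indicator C z) * (of_real (a z) + \<i> * of_real (b z))) = g"
    by (auto simp: g_def indicator_def)
  ultimately have gb [measurable]: "g \<in> borel_measurable borel" by simp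
  have fg: "AE x in lebesgue. f x = g x"
    using AE_completion[OF a] AE_completion[OF b] AE_eq_0_outside_ess_support[of f]
  proof eventually_elim
    case (elim x)
    have "f x = of_real (a x) + \<i> * of_real (b x)" using elim(1,2) by (simp add: complex_eq_iff)
    moreover have "f x = 0" if "x \<notin> C" using that elim(3) \<rho>(3)[of x] by (auto simp: C_def)
    ultimately show ?case by (cases "x \<in> C") (auto simp: g_def)
  qed
  have "finite_norm r g"
  proof (cases "r = \<infinity>")
    case True
    define e where "e = esssup lebesgue (\<lambda>x. ennreal (norm (f x)))"
    have e: "e < \<infinity>" using norm True by (simp add: Lr_norm_def e_def)
    have "AE x in lebesgue. ennreal (norm (f x)) \<le> e" unfolding e_def by (rule esssup_AE)
    then have "AE x in lebesgue. norm (g x) \<le> enn2real e"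
      using fg
    proof eventually_elim
      case (elim x)
      then show ?case using enn2real_mono[of "ennreal (norm (f x))" e] e by simp
    qed
    then have "AE x in lborel. norm (g x) \<le> enn2real e"
      by (simp add: AE_completion_iff)
    then show ?thesis using True by (auto simp: finite_norm_def)
  next
    case False
    have "(\<integral>\<^sup>+ x. ennreal (norm (g x) powr enn2real r) \<partial>lborel) = (\<integral>\<^sup>+ x. ennreal (norm (g x) powr enn2real r) \<partial>lebesgue)"
      by (rule nn_integral_completion[symmetric])
    also have "\<dots> = (\<integral>\<^sup>+ x. ennreal (norm (f x) powr enn2real r) \<partial>lebesgue)"
      by (rule nn_integral_cong_AE, use fg in eventually_elim) simp
    also have "\<dots> < \<infinity>"
      using norm False by (auto simp: Lr_norm_def Let_def less_top split: if_splits)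
    finally show ?thesis using False by (simp add: finite_norm_def)
  qed
  moreover have "norm (z $ i) \<le> \<rho>" if "g z \<noteq> 0" for z i
    using that by (cases "z \<in> C") (auto simp: g_def C_def)
  ultimately have "tame r g" using gb \<rho>(1,2) unfolding tame_def by blast
  then show ?thesis using fg that by blast
qed

lemma dist_of_eq_pair:
  fixes g :: "'a::euclidean_space \<Rightarrow> complex"
  assumes "AE x in lebesgue. f x = g x" and f: "f \<in> borel_measurable lebesgue"
    and [measurable]: "g \<in> borel_measurable borel" "\<phi> \<in> borel_measurable borel"
  shows "dist_of f \<phi> = pair g \<phi>"
proof -
  have l: "(\<lambda>x. g x * \<phi> x) \<in> borel_measurable lborel" by measurable
  have \<phi>l: "\<phi> \<in> borel_measurable lebesgue" by (rule measurable_completion) simp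
  have "dist_of f \<phi> = (LINT x|lebesgue. g x * \<phi> x)"
    unfolding dist_of_def
  proof (rule integral_cong_AE)
    show "(\<lambda>x. f x * \<phi> x) \<in> borel_measurable lebesgue" by (intro borel_measurable_times f \<phi>l)
    show "(\<lambda>x. g x * \<phi> x) \<in> borel_measurable lebesgue" by (rule measurable_completion[OF l])
    show "AE x in lebesgue. f x * \<phi> x = g x * \<phi> x" using assms(1) by eventually_elim simp
  qed
  also have "\<dots> = pair g \<phi>" unfolding pair_def by (rule integral_completion[OF l])
  finally show ?thesis .
qed

lemma tame_cmult: "tame r f \<Longrightarrow> norm c = 1 \<Longrightarrow> tame r (\<lambda>z. c * f z)"
  by (rule tame_mono[of r f]) (auto simp: tame_def norm_mult)

lemma pair_cmult: "pair (\<lambda>z. c * f z) \<phi> = c * pair f \<phi>"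
  unfolding pair_def mult.assoc by (rule integral_mult_right_zero)

subsection \<open>Signs\<close>

text \<open>The sign with which the k-th derivative enters the top coefficient of
  \<open>dbar\<close>. Multiplying the coefficients of a hat form by it turns that coefficient into
  a divergence, up to an overall sign.\<close>

definition hat_sign :: "'n::{finite,linorder} \<Rightarrow> complex" where
  "hat_sign k = (-1) ^ card {i. i < k}"

lemma hat_sign_square: "hat_sign k * hat_sign k = 1"
  by (simp add: hat_sign_def flip: power_mult_distrib)

lemma norm_hat_sign: "norm (hat_sign k) = 1"
  by (simp add: hat_sign_def norm_power)

lemma hat_form_hat: "hat_form w (UNIV - {k}) = w k"
proof
  fix z
  have "UNIV - {k} = UNIV - {j} \<longleftrightarrow> j = k" for j by blast
  then show "hat_form w (UNIV - {k}) z = w k z" by (simp add: hat_form_def)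
qed

text \<open>Leaving out \<open>j\<close> lowers the number of indices below \<open>k\<close> by one
  exactly when \<open>j < k\<close>.\<close>

lemma sign_hat:
  assumes "k \<noteq> j"
  shows "(-1) ^ card {i \<in> UNIV - {j}. i < k} = (if k < j then hat_sign k else - hat_sign k)"
proof (cases "k < j")
  case True
  then have "{i \<in> UNIV - {j}. i < k} = {i. i < k}" by auto
  then show ?thesis using True by (simp add: hat_sign_def)
next
  case False
  then have "{i. i < k} = insert j {i \<in> UNIV - {j}. i < k}" using assms by auto
  then have "card {i. i < k} = Suc (card {i \<in> UNIV - {j}. i < k})" by simp
  then show ?thesis using False by (simp add: hat_sign_def)
qed

text \<open>With at least two coordinates, such an \<open>I\<close> misses exactly two indices, and
  \<open>Min\<close> and \<open>Max\<close> list them in order. The signs are chosen so that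
  \<open>dbar\<close> of this form becomes the divergence of \<open>b\<close>, up to the factor
  \<open>hat_sign\<close>.\<close>

definition form_of_tensor :: "('n \<Rightarrow> 'n \<Rightarrow> complex ^ ('n::{finite,linorder}) \<Rightarrow> complex) \<Rightarrow> 'n form" where
  "form_of_tensor b I z =
     (if card I = CARD('n) - 2
      then hat_sign (Min (- I)) * hat_sign (Max (- I)) * b (Min (- I)) (Max (- I)) z else 0)"

text \<open>Exchanging the order of \<open>j\<close> and \<open>k\<close> changes the sign in
  \<open>sign_hat\<close> and swaps the indices of \<open>b\<close>; antisymmetry makes the two
  effects cancel, so one formula holds in both cases.\<close>

lemma form_of_tensor_pair:
  fixes b :: "'n \<Rightarrow> 'n \<Rightarrow> complex ^ ('n::{finite,linorder}) \<Rightarrow> complex"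
  assumes anti: "\<And>i j z. b i j z = - b j i z" and "k \<noteq> j"
  shows "(-1) ^ card {i \<in> UNIV - {j}. i < k} * form_of_tensor b (UNIV - {j} - {k}) z = hat_sign j * b k j z"
proof -
  have c: "- (UNIV - {j} - {k}) = {j, k}" by auto
  have "card (UNIV - {j} - {k}) = CARD('n) - 2"
    using assms(2) by (simp add: card_Diff_singleton)
  then have *: "form_of_tensor b (UNIV - {j} - {k}) z = hat_sign (Min {j, k}) * hat_sign (Max {j, k}) * b (Min {j, k}) (Max {j, k}) z"
    unfolding form_of_tensor_def c by simp
  show ?thesis
  proof (cases "k < j")
    case True
    then have "Min {j, k} = k" "Max {j, k} = j" by (auto simp: min_def max_def)
    then show ?thesis using True unfolding * sign_hat[OF assms(2)]
      by (simp add: mult.assoc[symmetric] hat_sign_square)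
  next
    case False
    then have jk: "j < k" using assms(2) by auto
    then have "Min {j, k} = j" "Max {j, k} = k" by (auto simp: min_def max_def)
    then have "(-1) ^ card {i \<in> UNIV - {j}. i < k} * form_of_tensor b (UNIV - {j} - {k}) z
        = (hat_sign k * hat_sign k) * (hat_sign j * - b j k z)"
      using False unfolding * sign_hat[OF assms(2)] by (simp add: mult_ac)
    then show ?thesis using anti[of k j z] by (simp add: hat_sign_square)
  qed
qed

section \<open>From the form to a vector field and back\<close>

theorem theorem7p4:
  fixes r :: ennreal
    and \<omega> :: "'n \<Rightarrow> complex ^ ('n::{finite,linorder}) \<Rightarrow> complex"
  assumes "CARD('n) \<ge> 2"
    and "1 \<le> r"
    and "\<And>j. \<omega> j \<in> Lr_c r polydisc"
    and "current_eq (dbar (current_of (hat_form \<omega>))) (\<lambda>J \<phi>. 0)"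
    and "\<exists>g \<in> Lr_space r. dist_eq (dist_dzbar (Max UNIV) (dist_of (\<omega> (Max UNIV)))) (dist_of g)"
  shows "\<exists>\<beta> \<in> forms (CARD('n) - 2) (Lr_c r polydisc).
           current_eq (dbar (current_of \<beta>)) (current_of (hat_form \<omega>))"
proof -
  have "\<exists>g. tame r g \<and> (AE x in lebesgue. \<omega> j x = g x)" for j
    by (rule Lr_c_imp_tame[OF assms(3)[of j]]) blast
  then obtain g where "\<forall>j. tame r (g j) \<and> (AE x in lebesgue. \<omega> j x = g j x)"
    using choice[of "\<lambda>j g. tame r g \<and> (AE x in lebesgue. \<omega> j x = g x)"] by blast
  then have g: "tame r (g j)" "AE x in lebesgue. \<omega> j x = g j x" for j by auto
  have \<omega>_pair: "dist_of (\<omega> j) \<phi> = pair (g j) \<phi>" if "test_function \<phi>" for j \<phi>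
    by (rule dist_of_eq_pair[OF g(2) _ tame_measurable[OF g(1)] test_function_measurable[OF that]])
      (use assms(3) in \<open>auto simp: Lr_c_def Lr_space_def\<close>)
  have tame_pair: "dist_of f \<phi> = pair f \<phi>" if "tame r f" "test_function \<phi>" for f and \<phi> :: "complex ^ ('n::{finite,linorder}) \<Rightarrow> complex"
    by (rule dist_of_eq_pair[OF _ _ tame_measurable[OF that(1)] test_function_measurable[OF that(2)]])
      (use tame_imp_Lr_c[OF that(1)] in \<open>auto simp: Lr_c_def Lr_space_def\<close>)
  define u where "u j z = hat_sign j * g j z" for j z
  have u: "tame r (u j)" for j unfolding u_def by (intro tame_cmult g norm_hat_sign)
  have pair_u: "pair (u j) \<phi> = hat_sign j * pair (g j) \<phi>" for j \<phi>
    unfolding u_def by (rule pair_cmult)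
  have "divfree u"
    unfolding divfree_def
  proof (intro allI impI)
    fix \<phi> :: "complex ^ ('n::{finite,linorder}) \<Rightarrow> complex" assume \<phi>: "test_function \<phi>"
    have "0 = dbar (current_of (hat_form \<omega>)) UNIV \<phi>"
      using assms(4) \<phi> by (simp add: current_eq_def dist_eq_def)
    \<comment> \<open>The coefficient of \<open>dbar\<close> at \<open>UNIV\<close> has exactly the
      signs absorbed in \<open>u\<close>.\<close>
    also have "\<dots> = (\<Sum>k\<in>UNIV. - pair (u k) (wirtinger_bar k \<phi>))"
      unfolding dbar_def current_of_def dist_dzbar_def hat_form_hat
      by (intro sum.cong refl)
        (simp add: \<omega>_pair[OF test_function_wirtinger_bar[OF \<phi>]] pair_u hat_sign_def)
    finally show "(\<Sum>j\<in>UNIV. pair (u j) (wirtinger_bar j \<phi>)) = 0" by (simp add: sum_negf)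
  qed
  then obtain b where b: "\<And>i j. tame r (b i j)" "\<And>i j z. b i j z = - b j i z"
    and ub: "\<And>\<phi> j. test_function \<phi> \<Longrightarrow> pair (u j) \<phi> = - (\<Sum>i\<in>UNIV. pair (b i j) (wirtinger_bar i \<phi>))"
  proof (rule exists_potential[OF assms(2) u], goal_cases)
    case (1 b)
    show ?case by (rule that[of b]; fact 1)
  qed
  define \<beta> where "\<beta> = form_of_tensor b"
  have \<beta>0: "\<beta> I = (\<lambda>_. 0)" if "card I \<noteq> CARD('n) - 2" for I
    using that by (simp add: \<beta>_def form_of_tensor_def[abs_def])
  have \<beta>1: "tame r (\<beta> I)" for I
  proof (cases "card I = CARD('n) - 2")
    case True
    then show ?thesis unfolding \<beta>_def form_of_tensor_def[abs_def]
      by (simp add: tame_cmult[OF b(1)] norm_mult norm_hat_sign)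
  qed (simp add: \<beta>0 tame_zero)
  have "\<beta> \<in> forms (CARD('n) - 2) (Lr_c r polydisc)"
    by (simp add: forms_def \<beta>0 tame_imp_Lr_c[OF \<beta>1])
  moreover have "dbar (current_of \<beta>) J \<phi> = current_of (hat_form \<omega>) J \<phi>" if \<phi>: "test_function \<phi>" for J \<phi>
  proof -
    have lhs: "dbar (current_of \<beta>) J \<phi> =
        - (\<Sum>k\<in>J. (-1) ^ card {i \<in> J. i < k} * pair (\<beta> (J - {k})) (wirtinger_bar k \<phi>))"
      by (simp add: dbar_def current_of_def dist_dzbar_def tame_pair[OF \<beta>1 test_function_wirtinger_bar[OF \<phi>]] sum_negf)
    show ?thesis
    \<comment> \<open>Either \<open>J\<close> misses a single index, and the equation is that of the
      corresponding component of \<open>u\<close>, or both sides vanish.\<close>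
    proof (cases "\<exists>j. J = UNIV - {j}")
      case True
      then obtain j where J: "J = UNIV - {j}" by blast
      have "(-1) ^ card {i \<in> J. i < k} * pair (\<beta> (J - {k})) \<psi> = hat_sign j * pair (b k j) \<psi>" if "k \<in> J" for k \<psi>
        unfolding pair_cmult[symmetric] \<beta>_def J
        by (subst form_of_tensor_pair[OF b(2)]) (use that J in auto)
      then have "dbar (current_of \<beta>) J \<phi> = - (hat_sign j * (\<Sum>k\<in>J. pair (b k j) (wirtinger_bar k \<phi>)))"
        unfolding lhs by (simp add: sum_distrib_left)
      also have "(\<Sum>k\<in>J. pair (b k j) (wirtinger_bar k \<phi>)) = (\<Sum>k\<in>UNIV. pair (b k j) (wirtinger_bar k \<phi>))"
      proof (rule sum.mono_neutral_left)
        \<comment> \<open>Antisymmetry kills the diagonal, so the index missing from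
          \<open>J\<close> may be added to the sum.\<close>
        have "b j j = (\<lambda>_. 0)" using b(2)[of j j] by (auto simp: eq_neg_iff_add_eq_0)
        then show "\<forall>k\<in>UNIV - J. pair (b k j) (wirtinger_bar k \<phi>) = 0"
          by (auto simp: J pair_zero_left)
      qed auto
      also have "- (hat_sign j * \<dots>) = hat_sign j * pair (u j) \<phi>" by (simp add: ub[OF \<phi>])
      also have "\<dots> = pair (g j) \<phi>" by (simp add: pair_u mult.assoc[symmetric] hat_sign_square)
      also have "\<dots> = current_of (hat_form \<omega>) J \<phi>"
        by (simp add: current_of_def J hat_form_hat \<omega>_pair[OF \<phi>])
      finally show ?thesis .
    next
      case False
      have "hat_form \<omega> J = (\<lambda>_. 0)" using False by (auto simp: hat_form_def intro!: sum.neutral)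
      then have rhs: "current_of (hat_form \<omega>) J \<phi> = 0" by (simp add: current_of_def dist_of_def)
      have "\<beta> (J - {k}) = (\<lambda>_. 0)" if "k \<in> J" for k
      proof (rule \<beta>0, rule notI)
        assume "card (J - {k}) = CARD('n) - 2"
        moreover have "card J = Suc (card (J - {k}))" by (rule card.remove) (use that in auto)
        \<comment> \<open>The bound on the number of coordinates enters here: it makes the natural
          number subtraction \<open>CARD('n) - 2\<close> exact, so that \<open>J\<close> has one
          element less than \<open>UNIV\<close>.\<close>
        ultimately have "card (- J) = 1" using assms(1) by (simp add: Compl_eq_Diff_UNIV card_Diff_subset)
        then obtain j where "- J = {j}" by (auto simp: card_1_singleton_iff)
        then have "J = UNIV - {j}" by auto
        then show False using False by blast
      qed
      then show ?thesis unfolding lhs rhs by (simp add: pair_zero_left)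
    qed
  qed
  ultimately show ?thesis by (auto simp: current_eq_def dist_eq_def)
qed

end
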